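(* Let $n\ge2$ and let $\tau_{\mathbf k}^{(\bm\beta)}$ be the $\tau$-functions of type $nT$ attached to the lower triangular group element $g$ (see context). For all $(\mathbf k,\bm\beta)\in A_{n-1}\times\mathbb Z^n$, all proper nonempty subsets $I\subset\{0,1,\dots,n-1\}$ with complement $J=\{0,1,\dots,n-1\}\setminus I$, and all $a\in I$, writing $\delta_I=\sum_{i\in I}\delta_i$ and $\delta_J=\sum_{j\in J}\delta_j$, one has $$\tau_{\mathbf{k}}^{(\bm\beta+\delta_{I})}\tau_{\mathbf{k}}^{(\bm\beta+\delta_{J})}+\sum_{b\in J}\tau_{\mathbf{k}+\delta_{b}-\delta_{a}}^{(\bm\beta+\delta_{I})}\tau_{\mathbf{k}+\delta_{a}-\delta_{b}}^{(\bm\beta+\delta_{J})}=\sum_{a''\in I}\tau_{\mathbf{k}+\delta_{a''}-\delta_{a}}^{(\bm\beta+\delta_{I}-\delta_{a''})}\tau_{\mathbf{k}+\delta_{a}-\delta_{a''}}^{(\bm\beta+\delta_{J}+\delta_{a''})}.$$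
   Context: Lattices. $\delta_0,\dots,\delta_{n-1}$ is the standard basis of $\mathbb Z^n$. The root lattice is $A_{n-1}=\bigoplus_{i=1}^{n-1}\mathbb Z\alpha_i\subset\mathbb Z^n$, $\alpha_i=\delta_{i-1}-\delta_i$. Fock space. $F^{(n)}$ is the semi-infinite wedge space on $H^{(n)}=\mathbb C^n\otimes\mathbb C[z,z^{-1}]$ with basis $e_az^k$ ($0\le a\le n-1$, $k\in\mathbb Z$). Put ${}_a\psi^+_{(k)}=e_az^k\wedge$ (wedging) and ${}_a\psi^-_{(k)}=i(e_az^{-k-1})$ (contraction); these satisfy $[{}_a\psi^+_{(k)},{}_b\psi^-_{(l)}]_+=\delta_{ab}\delta_{k+l,-1}$, all other anticommutators being zero. The vacuum $v_0=e_0\wedge e_1\wedge\dots\wedge e_{n-1}\wedge ze_0\wedge ze_1\wedge\cdots$ satisfies ${}_a\psi^\pm_{(k)}v_0=0$ for $k\ge0$, and $F^{(n)}$ is generated from $v_0$ by these operators. The elementary wedges $M_{n-1}\cdots M_1M_0v_0$, where $M_a=M_a^+M_a^-$ and $M_a^\pm={}_a\psi^\pm_{(k_1)}\cdots{}_a\psi^\pm_{(k_s)}$ with $k_1<\dots<k_s\le-1$, form a basis, declared orthonormal for the bilinear form $\langle\,,\rangle$. Fermion fields: $\psi_a^\pm(z)=\sum_k{}_a\psi^\pm_{(k)}z^{-k-1}$. Translation operators. $Q_a$ ($0\le a\le n-1$) are the invertible operators on $F^{(n)}$ determined by $Q_a^{\pm1}v_0={}_a\psi^\pm_{(-1)}v_0$,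 $\psi_a^\pm(z)Q_a=z^{\pm1}Q_a\psi_a^\pm(z)$, $\psi_a^\pm(z)Q_b=-Q_b\psi_a^\pm(z)$ and $Q_aQ_b=-Q_bQ_a$ for $a\ne b$. For $\bm\beta=\sum\beta_a\delta_a\in\mathbb Z^n$ put $Q^{\bm\beta}=Q_0^{\beta_0}Q_1^{\beta_1}\cdots Q_{n-1}^{\beta_{n-1}}$, and for $\mathbf k\in A_{n-1}$ put $T^{\mathbf k}=Q^{-\mathbf k}$. Group element. Let $c^{a,b}_{k,\ell}$ ($0\le b<a\le n-1$, $k,\ell\in\mathbb Z$) be formal variables (they may also be specialised to complex numbers, all but finitely many zero). Let $\Gamma_{ab}=\sum_{k,\ell\in\mathbb Z}c^{a,b}_{k,\ell}\,{}_a\psi^+_{(-k-1)}\,{}_b\psi^-_{(-\ell-1)}$ and let $g=\exp(\Gamma_{10})\exp(\Gamma_{20})\exp(\Gamma_{21})\exp(\Gamma_{30})\cdots\exp(\Gamma_{n-1,n-2})$ (pairs $(a,b)$, $a>b$, ordered by increasing $a$, then increasing $b$), a map $F^{(n)}\to F^{(n)}[[c^{a,b}_{k,\ell}]]$. It is the lift, normalised by $\langle v_0,gv_0\rangle=1$, of the infinite matrix $1+\sum_{a>b}\sum_{k,\ell}c^{a,b}_{k,\ell}E_{ab}^{-k-1,\ell}$, where $E_{ab}^{k,\ell}e_cz^m=\delta_{bc}\delta_{\ell m}e_az^k$. $\tau$-functions of type $nT$. $g^{(\bm\beta)}=Q^{\bm\beta}g(Q^{\bm\beta})^{-1}$ and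 $\tau_{\mathbf k}^{(\bm\beta)}=\langle T^{\mathbf k}v_0,g^{(\bm\beta)}v_0\rangle$. *)

theory Defs
  imports Complex_Main "HOL-Library.Function_Algebras" "HOL-Library.Poly_Mapping"
begin

definition int_lattice :: "nat \<Rightarrow> (nat \<Rightarrow> int) set" where
  "int_lattice n = {\<beta>. \<forall>i\<ge>n. \<beta> i = 0}"

definition delta :: "nat \<Rightarrow> nat \<Rightarrow> int" where
  "delta i = (\<lambda>j. if j = i then 1 else 0)"

definition delta_set :: "nat set \<Rightarrow> nat \<Rightarrow> int" where
  "delta_set I = (\<Sum>i\<in>I. delta i)"

definition root_lattice :: "nat \<Rightarrow> (nat \<Rightarrow> int) set" where
  "root_lattice n =
     {\<kappa>. \<exists>m :: nat \<Rightarrow> int. \<kappa> = (\<Sum>i = 1..n-1. (\<lambda>j. m i * (delta (i-1) - delta i) j))}"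

text \<open>
  The pair \<open>(a, k)\<close> stands for the basis vector \<open>e_a z^k\<close>.  These vectors are ordered as they
  occur in the vacuum, i.e. first by \<open>k\<close> and then by \<open>a\<close>.  A semi-infinite monomial is a set of
  such pairs, standing for the wedge product of its elements in increasing order; a vector is
  given by its coefficients with respect to these monomials.
\<close>

type_synonym site = "nat \<times> int"
type_synonym fock = "site set \<Rightarrow> complex"

definition sea :: "nat \<Rightarrow> site set" where
  "sea n = {0..<n} \<times> {0..}"

definition semi_infinite :: "nat \<Rightarrow> site set \<Rightarrow> bool" where
  "semi_infinite n S \<longleftrightarrow> S \<subseteq> {0..<n} \<times> UNIV \<and> finite (S - sea n) \<and> finite (sea n - S)"

definition Fock :: "nat \<Rightarrow> fock set" where
  "Fock n = {v. finite {S. v S \<noteq> 0} \<and> (\<forall>S. v S \<noteq> 0 \<longrightarrow> semi_infinite n S)}"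

definition monomial :: "site set \<Rightarrow> fock" where
  "monomial S = (\<lambda>T. if T = S then 1 else 0)"

definition vac :: "nat \<Rightarrow> fock" where
  "vac n = monomial (sea n)"

definition scale :: "complex \<Rightarrow> fock \<Rightarrow> fock" where
  "scale c v = (\<lambda>S. c * v S)"

fun before :: "site \<Rightarrow> site \<Rightarrow> bool" where
  "before (a, k) (b, l) \<longleftrightarrow> k < l \<or> (k = l \<and> a < b)"

text \<open>The sign of moving \<open>x\<close> from the front to its place in the ordered wedge \<open>S\<close>.\<close>

definition reorder_sign :: "site \<Rightarrow> site set \<Rightarrow> complex" where
  "reorder_sign x S = (- 1) ^ card {y \<in> S. before y x}"

definition wedge :: "site \<Rightarrow> fock \<Rightarrow> fock" where
  "wedge x v = (\<lambda>T. if x \<in> T then reorder_sign x (T - {x}) * v (T - {x}) else 0)"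

definition contract :: "site \<Rightarrow> fock \<Rightarrow> fock" where
  "contract x v = (\<lambda>T. if x \<notin> T then reorder_sign x T * v (insert x T) else 0)"

text \<open>The operators with upper index \<open>+\<close> and \<open>-\<close> are \<open>psi 1 a k\<close> and \<open>psi (- 1) a k\<close>.\<close>

definition psi :: "int \<Rightarrow> nat \<Rightarrow> int \<Rightarrow> fock \<Rightarrow> fock" where
  "psi s a k = (if s = 1 then wedge (a, k) else contract (a, - k - 1))"

text \<open>
  \<open>field_coeff s a j\<close> is the coefficient of \<open>z^j\<close> in the fermion field.  Consequently the
  coefficient of \<open>z^j\<close> in \<open>z^s\<close> times the field is \<open>field_coeff s a (j - s)\<close>.
\<close>

definition field_coeff :: "int \<Rightarrow> nat \<Rightarrow> int \<Rightarrow> fock \<Rightarrow> fock" where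
  "field_coeff s a j = psi s a (- j - 1)"

text \<open>
  The monomials are an orthonormal basis for this form.  The elementary wedges
  \<open>M_{n-1} \<dots> M_0 v_0\<close> are equal to them up to signs, hence are orthonormal for the same form; see
  \<open>elementary_wedge_monomial\<close> and \<open>inner_elementary_wedges\<close> below.
\<close>

definition inner :: "fock \<Rightarrow> fock \<Rightarrow> complex" where
  "inner u v = (\<Sum>S | u S \<noteq> 0 \<and> v S \<noteq> 0. u S * v S)"

text \<open>
  \<open>elementary_wedge n P N\<close> is \<open>M_{n-1} \<dots> M_0 v_0\<close>, where \<open>P a\<close> and \<open>N a\<close> are the sets of the
  mode numbers occurring in \<open>M_a^+\<close> and in \<open>M_a^-\<close>.
\<close>

definition psi_product :: "int \<Rightarrow> nat \<Rightarrow> int set \<Rightarrow> fock \<Rightarrow> fock" where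
  "psi_product s a K = foldr (psi s a) (sorted_list_of_set K)"

fun elementary_wedge_upto :: "nat \<Rightarrow> nat \<Rightarrow> (nat \<Rightarrow> int set) \<Rightarrow> (nat \<Rightarrow> int set) \<Rightarrow> fock" where
  "elementary_wedge_upto n 0 P N = vac n"
| "elementary_wedge_upto n (Suc a) P N =
     psi_product 1 a (P a) (psi_product (- 1) a (N a) (elementary_wedge_upto n a P N))"

abbreviation elementary_wedge :: "nat \<Rightarrow> (nat \<Rightarrow> int set) \<Rightarrow> (nat \<Rightarrow> int set) \<Rightarrow> fock" where
  "elementary_wedge n \<equiv> elementary_wedge_upto n n"

definition wedge_sites :: "nat \<Rightarrow> nat \<Rightarrow> (nat \<Rightarrow> int set) \<Rightarrow> (nat \<Rightarrow> int set) \<Rightarrow> site set" where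
  "wedge_sites n m P N =
     (sea n - {(a, - k - 1) | a k. a < m \<and> k \<in> N a}) \<union> {(a, k). a < m \<and> k \<in> P a}"

lemma wedge_monomial:
  assumes "x \<notin> S" shows "wedge x (scale c (monomial S)) = scale (reorder_sign x S * c) (monomial (insert x S))"
  using assms by (auto simp: wedge_def scale_def monomial_def fun_eq_iff)

lemma contract_monomial:
  assumes "x \<in> S"
  shows "contract x (scale c (monomial S)) = scale (reorder_sign x (S - {x}) * c) (monomial (S - {x}))"
  using assms by (auto simp: contract_def scale_def monomial_def fun_eq_iff)

lemma psi_monomial:
  "(a, k) \<notin> S \<Longrightarrow>
     psi 1 a k (scale c (monomial S)) = scale (reorder_sign (a, k) S * c) (monomial (insert (a, k) S))"
  "(a, - k - 1) \<in> S \<Longrightarrow>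
     psi (- 1) a k (scale c (monomial S)) =
       scale (reorder_sign (a, - k - 1) (S - {(a, - k - 1)}) * c) (monomial (S - {(a, - k - 1)}))"
  by (simp_all add: psi_def wedge_monomial contract_monomial)

lemma reorder_sign_cases: "reorder_sign x S = 1 \<or> reorder_sign x S = - 1"
  by (metis reorder_sign_def neg_one_even_power neg_one_odd_power)

lemma psi_list_plus:
  assumes "distinct ks" "\<And>k. k \<in> set ks \<Longrightarrow> (a, k) \<notin> S" "c = 1 \<or> c = - 1"
  shows "\<exists>d. (d = 1 \<or> d = - 1) \<and>
           foldr (psi 1 a) ks (scale c (monomial S)) = scale d (monomial (S \<union> Pair a ` set ks))"
  using assms
proof (induction ks)
  case Nil
  then show ?case by auto
next
  case (Cons k ks)
  then obtain d where d: "d = 1 \<or> d = - 1"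
    "foldr (psi 1 a) ks (scale c (monomial S)) = scale d (monomial (S \<union> Pair a ` set ks))" by auto
  have "(a, k) \<notin> S \<union> Pair a ` set ks" using Cons.prems by auto
  from psi_monomial(1)[OF this, of d] d
  have "foldr (psi 1 a) (k # ks) (scale c (monomial S)) =
      scale (reorder_sign (a, k) (S \<union> Pair a ` set ks) * d) (monomial (S \<union> Pair a ` set (k # ks)))"
    by simp
  moreover have "reorder_sign (a, k) (S \<union> Pair a ` set ks) * d = 1
      \<or> reorder_sign (a, k) (S \<union> Pair a ` set ks) * d = - 1"
    using d(1) reorder_sign_cases[of "(a, k)" "S \<union> Pair a ` set ks"] by auto
  ultimately show ?case by blast
qed

lemma psi_list_minus:
  assumes "distinct ks" "\<And>k. k \<in> set ks \<Longrightarrow> (a, - k - 1) \<in> S" "c = 1 \<or> c = - 1"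
  shows "\<exists>d. (d = 1 \<or> d = - 1) \<and> foldr (psi (- 1) a) ks (scale c (monomial S)) =
           scale d (monomial (S - (\<lambda>k. (a, - k - 1)) ` set ks))"
  using assms
proof (induction ks)
  case Nil
  then show ?case by auto
next
  case (Cons k ks)
  let ?S = "S - (\<lambda>k. (a, - k - 1)) ` set ks"
  obtain d where d: "d = 1 \<or> d = - 1"
    "foldr (psi (- 1) a) ks (scale c (monomial S)) = scale d (monomial ?S)" using Cons by auto
  have mem: "(a, - k - 1) \<in> ?S" using Cons.prems by auto
  have eq: "S - (\<lambda>k. (a, - k - 1)) ` set (k # ks) = ?S - {(a, - k - 1)}" by auto
  have "foldr (psi (- 1) a) (k # ks) (scale c (monomial S)) =
      scale (reorder_sign (a, - k - 1) (?S - {(a, - k - 1)}) * d) (monomial (?S - {(a, - k - 1)}))"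
    using psi_monomial(2)[OF mem, of d] d by simp
  moreover have "reorder_sign (a, - k - 1) (?S - {(a, - k - 1)}) * d = 1
      \<or> reorder_sign (a, - k - 1) (?S - {(a, - k - 1)}) * d = - 1"
    using d(1) reorder_sign_cases[of "(a, - k - 1)" "?S - {(a, - k - 1)}"] by auto
  ultimately show ?case unfolding eq by blast
qed

lemma elementary_wedge_monomial:
  assumes "\<And>a. a < m \<Longrightarrow> finite (P a) \<and> finite (N a) \<and> P a \<subseteq> {..-1} \<and> N a \<subseteq> {..-1}" "m \<le> n"
  shows "\<exists>c. (c = 1 \<or> c = - 1) \<and>
           elementary_wedge_upto n m P N = scale c (monomial (wedge_sites n m P N))"
  using assms
proof (induction m)
  case 0
  show ?case by (rule exI[of _ 1]) (simp add: vac_def wedge_sites_def scale_def)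
next
  case (Suc m)
  then obtain c where c: "c = 1 \<or> c = - 1"
    "elementary_wedge_upto n m P N = scale c (monomial (wedge_sites n m P N))" by force
  have fin: "finite (P m)" "finite (N m)" "P m \<subseteq> {..-1}" "N m \<subseteq> {..-1}" using Suc.prems by auto
  let ?S = "wedge_sites n m P N - (\<lambda>k. (m, - k - 1)) ` N m"
  have in_minus: "(m, - k - 1) \<in> wedge_sites n m P N" if "k \<in> N m" for k
    using that fin Suc.prems(2) by (auto simp: wedge_sites_def sea_def)
  have notin_plus: "(m, k) \<notin> ?S" if "k \<in> P m" for k
    using that fin by (auto simp: wedge_sites_def sea_def)
  obtain d where d: "d = 1 \<or> d = - 1"
    "psi_product (- 1) m (N m) (scale c (monomial (wedge_sites n m P N))) = scale d (monomial ?S)"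
    unfolding psi_product_def
    using psi_list_minus[of "sorted_list_of_set (N m)" m "wedge_sites n m P N" c] fin in_minus c(1)
    by auto
  obtain e where e: "e = 1 \<or> e = - 1"
    "psi_product 1 m (P m) (scale d (monomial ?S)) = scale e (monomial (?S \<union> Pair m ` P m))"
    unfolding psi_product_def
    using psi_list_plus[of "sorted_list_of_set (P m)" m ?S d] fin notin_plus d(1) by auto
  moreover have "?S \<union> Pair m ` P m = wedge_sites n (Suc m) P N"
    using fin by (auto simp: wedge_sites_def sea_def less_Suc_eq)
  ultimately show ?case using c d e by auto
qed

lemma inner_monomials: "inner (scale c (monomial S)) (scale d (monomial T)) = (if S = T then c * d else 0)"
proof -
  have "{R. scale c (monomial S) R \<noteq> 0 \<and> scale d (monomial T) R \<noteq> 0} =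
        (if S = T \<and> c \<noteq> 0 \<and> d \<noteq> 0 then {S} else {})"
    by (auto simp: scale_def monomial_def split: if_splits)
  then show ?thesis unfolding inner_def by (auto simp: scale_def monomial_def)
qed

lemma wedge_sites_inject:
  assumes PN: "\<And>a. a < n \<Longrightarrow> P a \<subseteq> {..-1} \<and> N a \<subseteq> {..-1}"
    and PN': "\<And>a. a < n \<Longrightarrow> P' a \<subseteq> {..-1} \<and> N' a \<subseteq> {..-1}"
  shows "wedge_sites n n P N = wedge_sites n n P' N' \<longleftrightarrow> (\<forall>a<n. P a = P' a \<and> N a = N' a)"
proof -
  have mem: "{k. k < 0 \<and> (a, k) \<in> wedge_sites n n P N} = P a"
      "{k. k < 0 \<and> (a, - k - 1) \<notin> wedge_sites n n P N} = N a"
    if "a < n" "P a \<subseteq> {..-1} \<and> N a \<subseteq> {..-1}" for a P N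
  proof -
    have neg: "j < 0" if "j \<in> P a \<or> j \<in> N a" for j
      using that \<open>P a \<subseteq> {..-1} \<and> N a \<subseteq> {..-1}\<close> by auto
    have sites: "(a, j) \<in> wedge_sites n n P N \<longleftrightarrow> 0 \<le> j \<and> - j - 1 \<notin> N a \<or> j \<in> P a" for j
      using that(1) by (auto simp: wedge_sites_def sea_def)
    show "{k. k < 0 \<and> (a, k) \<in> wedge_sites n n P N} = P a"
      using neg by (auto simp: sites)
    show "{k. k < 0 \<and> (a, - k - 1) \<notin> wedge_sites n n P N} = N a"
    proof (intro set_eqI)
      fix k
      show "k \<in> {k. k < 0 \<and> (a, - k - 1) \<notin> wedge_sites n n P N} \<longleftrightarrow> k \<in> N a"
        using neg[of k] neg[of "- k - 1"] by (auto simp: sites)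
    qed
  qed
  show ?thesis
  proof
    assume eq: "wedge_sites n n P N = wedge_sites n n P' N'"
    show "\<forall>a<n. P a = P' a \<and> N a = N' a"
    proof (intro allI impI)
      fix a assume a: "a < n"
      show "P a = P' a \<and> N a = N' a"
        using mem[of a P N, OF a PN[OF a]] mem[of a P' N', OF a PN'[OF a]] eq by simp
    qed
  next
    assume "\<forall>a<n. P a = P' a \<and> N a = N' a"
    then have "{(a, - k - 1) | a k. a < n \<and> k \<in> N a} = {(a, - k - 1) | a k. a < n \<and> k \<in> N' a}"
      "{(a, k). a < n \<and> k \<in> P a} = {(a, k). a < n \<and> k \<in> P' a}" by auto
    then show "wedge_sites n n P N = wedge_sites n n P' N'"
      by (simp only: wedge_sites_def)
  qed
qed

lemma inner_elementary_wedges: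
  assumes "\<And>a. a < n \<Longrightarrow> finite (P a) \<and> finite (N a) \<and> P a \<subseteq> {..-1} \<and> N a \<subseteq> {..-1}"
    and "\<And>a. a < n \<Longrightarrow> finite (P' a) \<and> finite (N' a) \<and> P' a \<subseteq> {..-1} \<and> N' a \<subseteq> {..-1}"
  shows "inner (elementary_wedge n P N) (elementary_wedge n P' N') =
           (if \<forall>a<n. P a = P' a \<and> N a = N' a then 1 else 0)"
proof (cases "\<forall>a<n. P a = P' a \<and> N a = N' a")
  case True
  have "elementary_wedge_upto n m P N = elementary_wedge_upto n m P' N'" if "m \<le> n" for m
    using that True by (induction m) auto
  moreover obtain c where "c = 1 \<or> c = - 1"
    "elementary_wedge n P N = scale c (monomial (wedge_sites n n P N))"
    using elementary_wedge_monomial[of n P N n] assms(1) by blast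
  ultimately show ?thesis using True by (auto simp: inner_monomials)
next
  case False
  then have "wedge_sites n n P N \<noteq> wedge_sites n n P' N'"
    using wedge_sites_inject[of n P N P' N'] assms by blast
  moreover obtain c where "elementary_wedge n P N = scale c (monomial (wedge_sites n n P N))"
    using elementary_wedge_monomial[of n P N n] assms(1) by blast
  moreover obtain d where "elementary_wedge n P' N' = scale d (monomial (wedge_sites n n P' N'))"
    using elementary_wedge_monomial[of n P' N' n] assms(2) by blast
  ultimately show ?thesis using False by (simp add: inner_monomials)
qed

definition translation_operators :: "nat \<Rightarrow> (nat \<Rightarrow> fock \<Rightarrow> fock) \<Rightarrow> bool" where
  "translation_operators n Q \<longleftrightarrow>
     (\<forall>a<n. bij_betw (Q a) (Fock n) (Fock n)
        \<and> (\<forall>u\<in>Fock n. \<forall>v\<in>Fock n. Q a (u + v) = Q a u + Q a v)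
        \<and> (\<forall>c. \<forall>v\<in>Fock n. Q a (scale c v) = scale c (Q a v))
        \<and> Q a (vac n) = psi 1 a (- 1) (vac n)
        \<and> inv_into (Fock n) (Q a) (vac n) = psi (- 1) a (- 1) (vac n)
        \<and> (\<forall>s\<in>{1, - 1}. \<forall>j. \<forall>v\<in>Fock n. field_coeff s a j (Q a v) = Q a (field_coeff s a (j - s) v)))
   \<and> (\<forall>a<n. \<forall>b<n. a \<noteq> b \<longrightarrow>
        (\<forall>s\<in>{1, - 1}. \<forall>j. \<forall>v\<in>Fock n. field_coeff s a j (Q b v) = - Q b (field_coeff s a j v))
        \<and> (\<forall>v\<in>Fock n. Q a (Q b v) = - Q b (Q a v)))"

definition Q_int_power :: "nat \<Rightarrow> (nat \<Rightarrow> fock \<Rightarrow> fock) \<Rightarrow> nat \<Rightarrow> int \<Rightarrow> fock \<Rightarrow> fock" where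
  "Q_int_power n Q a z =
     (if z \<ge> 0 then Q a ^^ nat z else inv_into (Fock n) (Q a) ^^ nat (- z))"

definition Q_power :: "nat \<Rightarrow> (nat \<Rightarrow> fock \<Rightarrow> fock) \<Rightarrow> (nat \<Rightarrow> int) \<Rightarrow> fock \<Rightarrow> fock" where
  "Q_power n Q \<beta> = foldr (\<lambda>a f. Q_int_power n Q a (\<beta> a) \<circ> f) [0..<n] id"

definition T_power :: "nat \<Rightarrow> (nat \<Rightarrow> fock \<Rightarrow> fock) \<Rightarrow> (nat \<Rightarrow> int) \<Rightarrow> fock \<Rightarrow> fock" where
  "T_power n Q \<kappa> = Q_power n Q (- \<kappa>)"

text \<open>
  The variable \<open>c^{a,b}_{k,l}\<close> is the quadruple \<open>(a, b, k, l)\<close>.  Only those with \<open>b < a < n\<close> ever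
  occur in the group element.  A power series is given by its coefficient function, sums are
  taken pointwise, and \<open>\<star>\<close> is the Cauchy product (the pointwise product of functions from
  Function-Algebras is not used).
\<close>

type_synonym var = "nat \<times> nat \<times> int \<times> int"
type_synonym expo = "var \<Rightarrow>\<^sub>0 nat"
type_synonym pseries = "expo \<Rightarrow> complex"
type_synonym fock_series = "expo \<Rightarrow> fock"

definition series_mult :: "pseries \<Rightarrow> pseries \<Rightarrow> pseries" (infixl "\<star>" 70) where
  "f \<star> g = (\<lambda>m. \<Sum>(p, q) | p + q = m. f p * g q)"

definition total_degree :: "expo \<Rightarrow> nat" where
  "total_degree m = (\<Sum>x\<in>Poly_Mapping.keys m. Poly_Mapping.lookup m x)"

text \<open>
  Substitution of complex numbers, almost all of them zero, for the variables.  In every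
  \<open>\<tau>\<close>-function the variables occur with exponent at most one (see \<open>group_element_multilinear\<close>
  below), so that only finitely many terms of the substituted series are nonzero.
\<close>

definition specialise :: "(var \<Rightarrow> complex) \<Rightarrow> pseries \<Rightarrow> complex" where
  "specialise \<gamma> f =
     (\<Sum>m | Poly_Mapping.keys m \<subseteq> {x. \<gamma> x \<noteq> 0} \<and> f m \<noteq> 0.
        f m * (\<Prod>x\<in>Poly_Mapping.keys m. \<gamma> x ^ Poly_Mapping.lookup m x))"

text \<open>
  The operator \<open>\<Gamma>_{ab}\<close>, extended \<open>\<complex>[[c]]\<close>-linearly to Fock-space-valued series: the coefficient at
  \<open>m\<close> of the product of \<open>c^{a,b}_{k,l}\<close> with a series is its coefficient at \<open>m - c^{a,b}_{k,l}\<close> if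
  the variable divides \<open>m\<close>, and zero otherwise.
\<close>

definition Gamma :: "nat \<Rightarrow> nat \<Rightarrow> fock_series \<Rightarrow> fock_series" where
  "Gamma a b f = (\<lambda>m. \<Sum>(k, l) | (a, b, k, l) \<in> Poly_Mapping.keys m.
     psi 1 a (- k - 1) (psi (- 1) b (- l - 1) (f (m - Poly_Mapping.single (a, b, k, l) 1))))"

text \<open>\<open>\<Gamma>_{ab}\<close> raises the degree by one, so the powers beyond the degree of \<open>m\<close> do not contribute.\<close>

definition exp_Gamma :: "nat \<Rightarrow> nat \<Rightarrow> fock_series \<Rightarrow> fock_series" where
  "exp_Gamma a b f =
     (\<lambda>m. \<Sum>N\<le>total_degree m. scale (1 / fact N) ((Gamma a b ^^ N) f m))"

definition const_series :: "fock \<Rightarrow> fock_series" where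
  "const_series v = (\<lambda>m. if m = 0 then v else 0)"

definition ordered_pairs :: "nat \<Rightarrow> (nat \<times> nat) list" where
  "ordered_pairs n = concat (map (\<lambda>a. map (\<lambda>b. (a, b)) [0..<a]) [0..<n])"

definition group_element :: "nat \<Rightarrow> fock \<Rightarrow> fock_series" where
  "group_element n v = foldr (\<lambda>(a, b). exp_Gamma a b) (ordered_pairs n) (const_series v)"

text \<open>
  Multilinearity of the group element in the variables, which makes specialisation meaningful.
  The operator multiplying \<open>c^{a,b}_{k,l}\<close> leaves \<open>e_a z^{-k-1}\<close> occupied and \<open>e_b z^l\<close>
  unoccupied, which is preserved by the other terms of \<open>\<Gamma>_{ab}\<close> and excludes a second
  application.
\<close>

lemma pair_operator_nonzeroD:
  assumes "a \<noteq> b" "psi 1 a (- k - 1) (psi (- 1) b (- l - 1) u) T \<noteq> 0"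
  shows "(a, - k - 1) \<in> T \<and> (b, l) \<notin> T \<and> u (insert (b, l) (T - {(a, - k - 1)})) \<noteq> 0"
  using assms by (auto simp: psi_def wedge_def contract_def split: if_splits)

lemma sum_fock_apply: "(\<Sum>i\<in>A. f i) T = (\<Sum>i\<in>A. (f i :: fock) T)"
  by (induction A rule: infinite_finite_induct) auto

lemma Gamma_power_multilinear:
  assumes "a \<noteq> b"
    and f: "\<And>m k l. f m \<noteq> 0 \<Longrightarrow> Poly_Mapping.lookup m (a, b, k, l) = 0"
    and nz: "(Gamma a b ^^ N) f m T \<noteq> 0"
  shows "(\<forall>k l. Poly_Mapping.lookup m (a, b, k, l) \<le> 1 \<and>
            (Poly_Mapping.lookup m (a, b, k, l) \<noteq> 0 \<longrightarrow> (a, - k - 1) \<in> T \<and> (b, l) \<notin> T))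
       \<and> (\<exists>p. f p \<noteq> 0 \<and> (\<forall>a' b' k l. (a', b') \<noteq> (a, b) \<longrightarrow>
            Poly_Mapping.lookup p (a', b', k, l) = Poly_Mapping.lookup m (a', b', k, l)))"
  using nz
proof (induction N arbitrary: m T)
  case 0
  then have "f m \<noteq> 0" by auto
  moreover have "Poly_Mapping.lookup m (a, b, k, l) = 0" for k l
    using f \<open>f m \<noteq> 0\<close> by blast
  ultimately show ?case by (metis zero_le_one)
next
  case (Suc N)
  let ?A = "{(k, l). (a, b, k, l) \<in> Poly_Mapping.keys m}"
  let ?u = "\<lambda>k l. (Gamma a b ^^ N) f (m - Poly_Mapping.single (a, b, k, l) 1)"
  let ?P = "\<lambda>k l. psi 1 a (- k - 1) (psi (- 1) b (- l - 1) (?u k l))"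
  have "(\<Sum>x\<in>?A. (case x of (k, l) \<Rightarrow> ?P k l) T) \<noteq> 0"
    using Suc.prems
    unfolding funpow.simps o_apply Gamma_def[of a b "(Gamma a b ^^ N) f"] sum_fock_apply .
  then obtain x where "x \<in> ?A" "(case x of (k, l) \<Rightarrow> ?P k l) T \<noteq> 0"
    by (meson sum.neutral)
  then obtain k l where kl: "(a, b, k, l) \<in> Poly_Mapping.keys m" "?P k l T \<noteq> 0" by (cases x) auto
  let ?m = "m - Poly_Mapping.single (a, b, k, l) 1"
  let ?T = "insert (b, l) (T - {(a, - k - 1)})"
  from pair_operator_nonzeroD[OF assms(1) kl(2)]
  have T: "(a, - k - 1) \<in> T" "(b, l) \<notin> T" and u: "?u k l ?T \<noteq> 0" by auto
  note IH = Suc.IH[OF u]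
  have "Poly_Mapping.lookup m (a, b, k', l') \<le> 1 \<and>
      (Poly_Mapping.lookup m (a, b, k', l') \<noteq> 0 \<longrightarrow> (a, - k' - 1) \<in> T \<and> (b, l') \<notin> T)" for k' l'
  proof (cases "k' = k \<and> l' = l")
    case True
    have "Poly_Mapping.lookup ?m (a, b, k, l) = 0" using IH by blast
    then have "Poly_Mapping.lookup m (a, b, k, l) \<le> 1" by (simp add: lookup_minus lookup_single when_def)
    then show ?thesis using True T by blast
  next
    case False
    then have "Poly_Mapping.lookup ?m (a, b, k', l') = Poly_Mapping.lookup m (a, b, k', l')"
      by (auto simp: lookup_minus lookup_single when_def)
    with IH have "Poly_Mapping.lookup m (a, b, k', l') \<le> 1"
      "Poly_Mapping.lookup m (a, b, k', l') \<noteq> 0 \<longrightarrow> (a, - k' - 1) \<in> ?T \<and> (b, l') \<notin> ?T" by metis+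
    then show ?thesis using T(1) assms(1) by auto
  qed
  moreover have "\<exists>p. f p \<noteq> 0 \<and> (\<forall>a' b' k l. (a', b') \<noteq> (a, b) \<longrightarrow>
      Poly_Mapping.lookup p (a', b', k, l) = Poly_Mapping.lookup m (a', b', k, l))"
  proof -
    have "Poly_Mapping.lookup ?m (a', b', k', l') = Poly_Mapping.lookup m (a', b', k', l')"
      if "(a', b') \<noteq> (a, b)" for a' b' k' l' using that by (auto simp: lookup_minus lookup_single when_def)
    then show ?thesis using IH by metis
  qed
  ultimately show ?case by blast
qed

lemma exp_Gamma_multilinear:
  assumes "a \<noteq> b"
    and f: "\<And>m k l. f m \<noteq> 0 \<Longrightarrow> Poly_Mapping.lookup m (a, b, k, l) = 0"
    and nz: "exp_Gamma a b f m \<noteq> 0"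
  shows "(\<forall>k l. Poly_Mapping.lookup m (a, b, k, l) \<le> 1)
       \<and> (\<exists>p. f p \<noteq> 0 \<and> (\<forall>a' b' k l. (a', b') \<noteq> (a, b) \<longrightarrow>
            Poly_Mapping.lookup p (a', b', k, l) = Poly_Mapping.lookup m (a', b', k, l)))"
proof -
  obtain N where "scale (1 / fact N) ((Gamma a b ^^ N) f m) \<noteq> 0"
    using nz unfolding exp_Gamma_def by (meson sum.neutral)
  then obtain T where "(Gamma a b ^^ N) f m T \<noteq> 0" by (auto simp: scale_def fun_eq_iff)
  from Gamma_power_multilinear[OF assms(1) f this] show ?thesis by blast
qed

lemma group_element_multilinear:
  assumes "group_element n v m \<noteq> 0"
  shows "Poly_Mapping.lookup m x \<le> 1"
proof -
  have "Poly_Mapping.lookup m (a, b, k, l) \<le> (if (a, b) \<in> set ps then 1 else 0)"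
    if "distinct ps" "\<forall>(a, b)\<in>set ps. a \<noteq> b"
      "foldr (\<lambda>(a, b). exp_Gamma a b) ps (const_series v) m \<noteq> 0" for ps m a b k l
    using that
  proof (induction ps arbitrary: m a b k l)
    case Nil
    then show ?case by (auto simp: const_series_def split: if_splits)
  next
    case (Cons p ps)
    obtain c d where p: "p = (c, d)" by force
    let ?f = "foldr (\<lambda>(a, b). exp_Gamma a b) ps (const_series v)"
    have IH: "Poly_Mapping.lookup q (a, b, k, l) \<le> (if (a, b) \<in> set ps then 1 else 0)"
      if "?f q \<noteq> 0" for q a b k l
      using Cons.IH[of q a b k l, OF _ _ that] Cons.prems(1,2) by simp
    have "c \<noteq> d" "(c, d) \<notin> set ps" "exp_Gamma c d ?f m \<noteq> 0" using Cons.prems p by auto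
    moreover have "Poly_Mapping.lookup q (c, d, k, l) = 0" if "?f q \<noteq> 0" for q k l
      using IH[OF that, of c d k l] \<open>(c, d) \<notin> set ps\<close> by simp
    ultimately have *: "\<forall>k l. Poly_Mapping.lookup m (c, d, k, l) \<le> 1"
      "\<exists>q. ?f q \<noteq> 0 \<and> (\<forall>a' b' k l. (a', b') \<noteq> (c, d) \<longrightarrow>
         Poly_Mapping.lookup q (a', b', k, l) = Poly_Mapping.lookup m (a', b', k, l))"
      using exp_Gamma_multilinear[of c d ?f m] by blast+
    show ?case
    proof (cases "(a, b) = (c, d)")
      case True
      then show ?thesis using *(1) p by simp
    next
      case False
      obtain q where q: "?f q \<noteq> 0" "\<forall>a' b' k l. (a', b') \<noteq> (c, d) \<longrightarrow>
         Poly_Mapping.lookup q (a', b', k, l) = Poly_Mapping.lookup m (a', b', k, l)"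
        using *(2) by blast
      then have "Poly_Mapping.lookup m (a, b, k, l) = Poly_Mapping.lookup q (a, b, k, l)"
        using False by metis
      then show ?thesis using IH[OF q(1), of a b k l] False p by (auto split: if_splits)
    qed
  qed
  moreover have "distinct (ordered_pairs n)"
    by (induction n) (auto simp: ordered_pairs_def distinct_map inj_on_def)
  moreover have "\<forall>(a, b)\<in>set (ordered_pairs n). a \<noteq> b"
    by (auto simp: ordered_pairs_def)
  ultimately have le: "Poly_Mapping.lookup m (a, b, k, l)
      \<le> (if (a, b) \<in> set (ordered_pairs n) then 1 else 0)" for a b k l
    using assms unfolding group_element_def by blast
  obtain a b k l where "x = (a, b, k, l)" by (cases x) auto
  then show ?thesis using le[of a b k l] by (auto split: if_splits)
qed

definition group_element_conj ::
    "nat \<Rightarrow> (nat \<Rightarrow> fock \<Rightarrow> fock) \<Rightarrow> (nat \<Rightarrow> int) \<Rightarrow> fock \<Rightarrow> fock_series" where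
  "group_element_conj n Q \<beta> v =
     (\<lambda>m. Q_power n Q \<beta> (group_element n (inv_into (Fock n) (Q_power n Q \<beta>) v) m))"

definition tau :: "nat \<Rightarrow> (nat \<Rightarrow> fock \<Rightarrow> fock) \<Rightarrow> (nat \<Rightarrow> int) \<Rightarrow> (nat \<Rightarrow> int) \<Rightarrow> pseries" where
  "tau n Q \<kappa> \<beta> =
     (\<lambda>m. inner (T_power n Q \<kappa> (vac n)) (group_element_conj n Q \<beta> (vac n) m))"

end

theory Submission
  imports Defs
begin

text \<open>
  On pairs of Fock vectors consider \<open>\<Omega> = \<Sum>\<^sub>z (wedge z) \<otimes> (contract z)\<close>, the sum over all sites.
  By the canonical anticommutation relations \<open>\<Omega>\<close> commutes with \<open>\<Gamma> \<otimes> 1 + 1 \<otimes> \<Gamma>\<close> for every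
  \<open>\<Gamma> = \<Gamma>_{ab}\<close>, hence with \<open>exp \<Gamma> \<otimes> exp \<Gamma>\<close>, hence with \<open>g \<otimes> g\<close>.  Put \<open>B = \<beta> + \<delta>\<^sub>I\<close>,
  \<open>C = \<beta> + \<delta>\<^sub>J\<close>, and take the matrix coefficient of \<open>\<Omega> (g \<otimes> g) = (g \<otimes> g) \<Omega>\<close> between the kets
  \<open>(Q^B)^{-1} v_0 \<otimes> (Q^C)^{-1} v_0\<close> and the bras
  \<open>(Q^B)^{-1} T^{\<kappa> - \<delta>_a} v_0 \<otimes> (Q^C)^{-1} T^{\<kappa> + \<delta>_a} v_0\<close>.
  All these vectors are monomials up to sign.  Letting \<open>\<Omega>\<close> act on the kets leaves one term for each
  element of \<open>I\<close>; letting its adjoint act on the bras leaves one term for each element of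
  \<open>J \<union> {a}\<close>.  Every term carries the same sign \<open>(-1)^(n-1)\<close>, which cancels.
\<close>

section \<open>Anticommutation relations and the bilinear operator\<close>

text \<open>A bilinear relation applies because \<open>\<beta>\<close> can be moved out of
  \<open>g\<close>: \<open>Q^\<beta>\<close> is an isometry, so every \<open>\<tau>\<close>-function
  is a matrix coefficient of the same \<open>g\<close>, taken between translated vectors. The
  translation operators are given by axioms only, hence the isometry has to be derived, by carrying
  their action on the vacuum over to all monomials. The shifts of the bras by
  \<open>\<delta>_a\<close> restore the charge balance: \<open>\<Omega>\<close> adds a particle in
  the first factor and removes one from the second. They also single out the colour
  \<open>a\<close>, whose term is the leading product of the identity. Two constraints shape the
  algebra. Reordering signs make sense only where finitely many sites precede a given one, so the
  relations are proved pointwise, at semi-infinite sets. And \<open>g\<close> acts on vectors, not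
  on tensors, so its commutation with \<open>\<Omega>\<close> is stated for products that
  \<open>\<Omega>\<close> turns into finite sums of products.\<close>

lemma before_cases: "x \<noteq> y \<Longrightarrow> before x y = (\<not> before y x)"
  by (cases x; cases y) auto

text \<open>On sets violating this condition \<open>reorder_sign\<close> is meaningless, an infinite set having \<open>card\<close> zero.\<close>

definition finite_below :: "site set \<Rightarrow> bool" where
  "finite_below S \<longleftrightarrow> (\<forall>x. finite {y \<in> S. before y x})"

lemma finite_below_insert [simp]: "finite_below (insert x S) \<longleftrightarrow> finite_below S"
proof
  assume "finite_below S"
  moreover have "{y \<in> insert x S. before y z} \<subseteq> insert x {y \<in> S. before y z}" for z
    by auto
  ultimately show "finite_below (insert x S)"
    unfolding finite_below_def by (meson finite_insert finite_subset)
next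
  assume "finite_below (insert x S)"
  moreover have "{y \<in> S. before y z} \<subseteq> {y \<in> insert x S. before y z}" for z
    by auto
  ultimately show "finite_below S"
    unfolding finite_below_def by (meson finite_subset)
qed

lemma finite_below_remove [simp]: "finite_below (S - {x}) \<longleftrightarrow> finite_below S"
  by (metis finite_below_insert insert_Diff_single)

lemma finite_below_semi_infinite:
  assumes "semi_infinite n S"
  shows "finite_below S"
  unfolding finite_below_def
proof
  fix x :: site
  obtain a k where x: "x = (a, k)" by force
  have "{y \<in> S. before y x} \<subseteq> (S - sea n) \<union> {0..<n} \<times> {0..k}"
    by (auto simp: x sea_def)
  then show "finite {y \<in> S. before y x}"
    using assms by (meson semi_infinite_def finite_SigmaI finite_UnI finite_atLeastAtMost_int
        finite_atLeastLessThan finite_subset)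
qed

lemma semi_infinite_insert:
  assumes "semi_infinite n S" "fst x < n"
  shows "semi_infinite n (insert x S)"
proof -
  have "insert x S - sea n \<subseteq> insert x (S - sea n)" "sea n - insert x S \<subseteq> sea n - S" by auto
  moreover have "insert x S \<subseteq> {0..<n} \<times> UNIV"
    using assms by (cases x) (auto simp: semi_infinite_def)
  ultimately show ?thesis using assms(1) unfolding semi_infinite_def
    by (meson finite_insert finite_subset)
qed

lemma semi_infinite_remove:
  assumes "semi_infinite n S"
  shows "semi_infinite n (S - {x})"
proof -
  have "sea n - (S - {x}) \<subseteq> insert x (sea n - S)" "S - {x} - sea n \<subseteq> S - sea n" by auto
  then show ?thesis using assms unfolding semi_infinite_def
    by (meson Diff_subset finite_insert finite_subset order_trans)
qed

lemma finite_semi_infinite_diff: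
  assumes "semi_infinite n S" "semi_infinite n T"
  shows "finite (S - T)"
proof -
  have "S - T \<subseteq> (S - sea n) \<union> (sea n - T)" by auto
  then show ?thesis using assms by (meson semi_infinite_def finite_UnI finite_subset)
qed

lemma reorder_sign_insert:
  assumes "finite_below S" "y \<notin> S"
  shows "reorder_sign x (insert y S) = (if before y x then - 1 else 1) * reorder_sign x S"
proof -
  have "{u \<in> insert y S. before u x} =
      (if before y x then insert y {u \<in> S. before u x} else {u \<in> S. before u x})"
    by auto
  moreover have "finite {u \<in> S. before u x}"
    using assms(1) by (auto simp only: finite_below_def)
  ultimately show ?thesis
    using assms(2) by (simp add: reorder_sign_def)
qed

lemma reorder_sign_square [simp]: "reorder_sign x S * reorder_sign x S = 1"
  by (metis reorder_sign_cases mult_minus_left mult_minus_right mult_1 minus_minus)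

lemma wedge_wedge:
  assumes "finite_below T"
  shows "wedge x (wedge y v) T = - wedge y (wedge x v) T"
proof (cases "x \<in> T \<and> y \<in> T \<and> x \<noteq> y")
  case True
  \<comment> \<open>Both sides reduce to the coefficient at \<open>U\<close>. Exactly one of the two
    sites precedes the other, so exactly one of the two orders of insertion picks up an extra
    sign.\<close>
  define U where "U = T - {x} - {y}"
  have U: "T - {x} = insert y U" "T - {y} = insert x U" "T - {y} - {x} = U" "finite_below U" "x \<notin> U" "y \<notin> U"
      "insert y U - {y} = U" "insert x U - {x} = U"
    using True assms by (auto simp: U_def)
  show ?thesis
    using True before_cases[of x y] U
    by (simp add: wedge_def reorder_sign_insert del: Diff_insert0)
next
  case False
  then show ?thesis by (auto simp: wedge_def)
qed

lemma contract_contract: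
  assumes "finite_below T"
  shows "contract x (contract y v) T = - contract y (contract x v) T"
proof (cases "x \<notin> T \<and> y \<notin> T \<and> x \<noteq> y")
  case True
  then show ?thesis
    using assms before_cases[of x y]
    by (auto simp: contract_def reorder_sign_insert insert_commute)
next
  case False
  then show ?thesis by (auto simp: contract_def)
qed

text \<open>For \<open>x = y\<close> exactly one of the two products survives at \<open>T\<close>,
  according to whether \<open>x\<close> lies in \<open>T\<close>, and its two reordering signs are
  equal. For distinct sites the signs differ by the relative order, as in the other two
  relations.\<close>

lemma wedge_contract:
  assumes "finite_below T"
  shows "wedge x (contract y v) T = (if x = y then v T else 0) - contract y (wedge x v) T"
proof (cases "x = y")
  case True
  then show ?thesis
    by (auto simp: wedge_def contract_def insert_absorb mult.assoc[symmetric])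
next
  case neq: False
  show ?thesis
  proof (cases "x \<in> T \<and> y \<notin> T")
    case True
    define U where "U = T - {x}"
    have U: "T = insert x U" "x \<notin> U" "y \<notin> U" "finite_below U"
      using True assms by (auto simp: U_def)
    have "insert y U - {x} = insert y U" "insert y (insert x U) - {x} = insert y U"
      using neq U by auto
    then show ?thesis
      using U neq before_cases[of x y]
      by (simp add: wedge_def contract_def reorder_sign_insert)
  next
    case False
    then show ?thesis using neq by (auto simp: wedge_def contract_def)
  qed
qed

text \<open>The anticommutation relations hold only at sets satisfying \<open>finite_below\<close>,
  so they cannot be used as equations between functions. This congruence allows rewriting under
  \<open>wedge\<close> at the single set that matters.\<close>

lemma wedge_cong: "(x \<in> T \<Longrightarrow> u (T - {x}) = v (T - {x})) \<Longrightarrow> wedge x u T = wedge x v T"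
  by (simp add: wedge_def)

lemma wedge_linear:
  "wedge x (\<lambda>S. u S + v S) = (\<lambda>S. wedge x u S + wedge x v S)"
  "wedge x (\<lambda>S. u S - v S) = (\<lambda>S. wedge x u S - wedge x v S)"
  "wedge x (\<lambda>S. - u S) = (\<lambda>S. - wedge x u S)"
  "wedge x (\<lambda>S. c * v S) = (\<lambda>S. c * wedge x v S)"
  "wedge x (\<lambda>S. v S * c) = (\<lambda>S. wedge x v S * c)"
  "wedge x (\<lambda>S. 0) = (\<lambda>S. 0)"
  "wedge x (\<lambda>S. \<Sum>i\<in>A. f i S) = (\<lambda>S. \<Sum>i\<in>A. wedge x (f i) S)"
  by (auto simp: wedge_def algebra_simps sum_distrib_left)

lemma contract_linear:
  "contract x (\<lambda>S. u S + v S) = (\<lambda>S. contract x u S + contract x v S)"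
  "contract x (\<lambda>S. u S - v S) = (\<lambda>S. contract x u S - contract x v S)"
  "contract x (\<lambda>S. - u S) = (\<lambda>S. - contract x u S)"
  "contract x (\<lambda>S. c * v S) = (\<lambda>S. c * contract x v S)"
  "contract x (\<lambda>S. v S * c) = (\<lambda>S. contract x v S * c)"
  "contract x (\<lambda>S. 0) = (\<lambda>S. 0)"
  "contract x (\<lambda>S. \<Sum>i\<in>A. f i S) = (\<lambda>S. \<Sum>i\<in>A. contract x (f i) S)"
  by (auto simp: contract_def algebra_simps sum_distrib_left)

section \<open>Matrix units and the invariance of the bilinear operator\<close>

definition hop :: "site \<Rightarrow> site \<Rightarrow> fock \<Rightarrow> fock" where
  "hop x y v = wedge x (contract y v)"

lemma hop_linear:
  "hop x y (\<lambda>S. u S + v S) = (\<lambda>S. hop x y u S + hop x y v S)"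
  "hop x y (\<lambda>S. c * v S) = (\<lambda>S. c * hop x y v S)"
  "hop x y (\<lambda>S. v S * c) = (\<lambda>S. hop x y v S * c)"
  "hop x y (\<lambda>S. \<Sum>i\<in>A. f i S) = (\<lambda>S. \<Sum>i\<in>A. hop x y (f i) S)"
  by (simp_all add: hop_def wedge_linear contract_linear)

lemma hop_cong:
  "(u (insert y (T - {x})) = v (insert y (T - {x}))) \<Longrightarrow> hop x y u T = hop x y v T"
  by (auto simp: hop_def wedge_def contract_def)

text \<open>\<open>hop x y\<close> lifts the matrix unit sending the basis vector of
  \<open>y\<close> to that of \<open>x\<close>. Its commutators with \<open>wedge z\<close> and
  \<open>contract z\<close> are \<open>- wedge x\<close> for \<open>z = y\<close> and
  \<open>contract y\<close> for \<open>z = x\<close>; these opposite signs make \<open>Omega\<close>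
  invariant.\<close>

lemma wedge_hop:
  assumes "finite_below T"
  shows "wedge z (hop x y v) T = hop x y (wedge z v) T - (if z = y then wedge x v T else 0)"
proof -
  have "wedge z (hop x y v) T = - wedge x (wedge z (contract y v)) T"
    unfolding hop_def by (rule wedge_wedge[OF assms])
  also have "wedge x (wedge z (contract y v)) T =
      wedge x (\<lambda>S. (if z = y then v S else 0) - contract y (wedge z v) S) T"
    using assms by (intro wedge_cong) (simp add: wedge_contract)
  finally show ?thesis by (cases "z = y") (simp_all add: wedge_linear hop_def)
qed

lemma contract_hop:
  assumes "finite_below T"
  shows "contract z (hop x y v) T = hop x y (contract z v) T + (if z = x then contract y v T else 0)"
proof -
  have "contract z (hop x y v) T = (if x = z then contract y v T else 0) - wedge x (contract z (contract y v)) T"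
    using assms by (simp add: hop_def wedge_contract)
  also have "wedge x (contract z (contract y v)) T = wedge x (\<lambda>S. - contract y (contract z v) S) T"
    by (intro wedge_cong contract_contract) (simp add: assms)
  finally show ?thesis by (auto simp: wedge_linear hop_def)
qed

type_synonym tensor = "site set \<Rightarrow> site set \<Rightarrow> complex"
type_synonym tensor_series = "expo \<Rightarrow> tensor"

text \<open>At the pair \<open>(S, T)\<close> the wedging needs \<open>z\<close> in \<open>S\<close>
  and the contraction needs \<open>z\<close> outside \<open>T\<close>, so the sum over all sites has
  support in \<open>S - T\<close>. For semi-infinite sets this is finite, although
  \<open>Omega\<close> has infinitely many summands as an operator.\<close>

definition Omega :: "tensor \<Rightarrow> tensor" where
  "Omega h S T = (\<Sum>z\<in>S - T. wedge z (\<lambda>S'. contract z (h S') T) S)"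

lemma Omega_superset:
  assumes "finite Z" "S - T \<subseteq> Z"
  shows "Omega h S T = (\<Sum>z\<in>Z. wedge z (\<lambda>S'. contract z (h S') T) S)"
  unfolding Omega_def
  by (rule sum.mono_neutral_left[OF assms]) (auto simp: wedge_def contract_def)

lemma Omega_linear:
  "Omega (\<lambda>S T. h S T + h' S T) S T = Omega h S T + Omega h' S T"
  "Omega (\<lambda>S T. c * h S T) S T = c * Omega h S T"
  "Omega (\<lambda>S T. \<Sum>i\<in>A. f i S T) S T = (\<Sum>i\<in>A. Omega (f i) S T)"
    apply (simp_all add: Omega_def wedge_linear contract_linear sum.distrib sum_distrib_left)
  by (rule sum.swap)

definition hop2 :: "site \<Rightarrow> site \<Rightarrow> tensor \<Rightarrow> tensor" where
  "hop2 x y h S T = hop x y (\<lambda>S'. h S' T) S + hop x y (h S) T"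

text \<open>Operators in different tensor factors commute without sign. Only the commutators within
  a factor remain, and both produce \<open>wedge x \<otimes> contract y\<close>, once with each
  sign.\<close>

lemma Omega_hop2:
  assumes "semi_infinite n S" "semi_infinite n T"
  shows "Omega (hop2 x y h) S T = hop2 x y (Omega h) S T"
proof -
  \<comment> \<open>A hop changes one of the sets by removing \<open>x\<close> and inserting
    \<open>y\<close>. Adjoining both sites gives one finite index set that serves the original pair
    and both changed pairs.\<close>
  define Z where "Z = (S - T) \<union> {x, y}"
  have fin: "finite Z" using finite_semi_infinite_diff[OF assms] by (simp add: Z_def)
  note fb = finite_below_semi_infinite[OF assms(1)] finite_below_semi_infinite[OF assms(2)]
  define \<phi> where "\<phi> = (\<lambda>z T S'. contract z (h S') T)"
  have 1: "hop x y (\<lambda>S'. Omega h S' T) S = (\<Sum>z\<in>Z. hop x y (wedge z (\<phi> z T)) S)"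
  proof -
    have "hop x y (\<lambda>S'. Omega h S' T) S = hop x y (\<lambda>S'. \<Sum>z\<in>Z. wedge z (\<phi> z T) S') S"
      unfolding \<phi>_def by (intro hop_cong Omega_superset fin) (auto simp: Z_def)
    then show ?thesis by (simp add: hop_linear)
  qed
  have 2: "hop x y (Omega h S) T = (\<Sum>z\<in>Z. wedge z (\<lambda>S'. hop x y (contract z (h S')) T) S)"
  proof -
    have "hop x y (Omega h S) T = hop x y (\<lambda>T'. \<Sum>z\<in>Z. wedge z (\<phi> z T') S) T"
      unfolding \<phi>_def by (intro hop_cong Omega_superset fin) (auto simp: Z_def)
    also have "\<dots> = (\<Sum>z\<in>Z. hop x y (\<lambda>T'. wedge z (\<phi> z T') S) T)"
      by (simp add: hop_linear)
    also have "\<dots> = (\<Sum>z\<in>Z. wedge z (\<lambda>S'. hop x y (contract z (h S')) T) S)"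
      by (intro sum.cong refl) (simp add: wedge_def hop_def contract_def \<phi>_def)
    finally show ?thesis .
  qed
  have 3: "wedge z (\<lambda>S'. contract z (hop2 x y h S') T) S =
       hop x y (wedge z (\<phi> z T)) S + wedge z (\<lambda>S'. hop x y (contract z (h S')) T) S
       + ((if z = x then wedge x (\<phi> y T) S else 0) - (if z = y then wedge x (\<phi> y T) S else 0))" for z
  proof -
    have "contract z (hop2 x y h S') T = hop x y (\<phi> z T) S' +
       (hop x y (contract z (h S')) T + (if z = x then \<phi> y T S' else 0))" for S'
    proof -
      have "contract z (\<lambda>T'. hop x y (\<lambda>S''. h S'' T') S') T = hop x y (\<phi> z T) S'"
        by (simp add: wedge_def hop_def contract_def \<phi>_def)
      then show ?thesis unfolding hop2_def
        by (simp add: contract_linear contract_hop fb) (simp add: \<phi>_def)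
    qed
    then show ?thesis
      by (cases "z = x"; cases "z = y") (simp_all add: wedge_linear wedge_hop fb)
  qed
  have "Omega (hop2 x y h) S T = (\<Sum>z\<in>Z. wedge z (\<lambda>S'. contract z (hop2 x y h S') T) S)"
    by (rule Omega_superset[OF fin]) (auto simp: Z_def)
  also have "\<dots> = hop x y (\<lambda>S'. Omega h S' T) S + hop x y (Omega h S) T
     + ((\<Sum>z\<in>Z. if z = x then wedge x (\<phi> y T) S else 0) - (\<Sum>z\<in>Z. if z = y then wedge x (\<phi> y T) S else 0))"
    unfolding 1 2 3 sum.distrib sum_subtractf by simp
  \<comment> \<open>Both \<open>x\<close> and \<open>y\<close> belong to \<open>Z\<close>, so each
    sum consists of the same single term, namely \<open>wedge x (\<phi> y T) S\<close>.\<close>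
  also have "(\<Sum>z\<in>Z. if z = x then wedge x (\<phi> y T) S else 0) - (\<Sum>z\<in>Z. if z = y then wedge x (\<phi> y T) S else 0) = 0"
    using fin by (simp add: Z_def)
  finally show ?thesis by (simp add: hop2_def[of _ _ "Omega h"])
qed

section \<open>Products of formal series and the Leibniz rule\<close>

lemma finite_decompositions: "finite {(p, q). p + q = (m :: expo)}"
proof -
  \<comment> \<open>A summand of \<open>m\<close> is supported on the keys of \<open>m\<close> and
    bounded there by the largest exponent. The inserted \<open>0\<close> makes the maximum
    meaningful for \<open>m = 0\<close>.\<close>
  let ?K = "Poly_Mapping.keys m" and ?b = "Max (insert 0 (Poly_Mapping.lookup m ` Poly_Mapping.keys m))"
  let ?F = "{f. \<forall>x. (x \<in> ?K \<longrightarrow> f x \<in> {0..?b}) \<and> (x \<notin> ?K \<longrightarrow> f x = 0)}"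
  have finF: "finite ?F" by (intro finite_set_of_finite_funs) auto
  have low: "Poly_Mapping.lookup p \<in> ?F" if "p + q = m" for p q
  proof -
    have le: "Poly_Mapping.lookup p x \<le> Poly_Mapping.lookup m x" for x using that by (auto simp: lookup_add)
    have "Poly_Mapping.lookup m x \<le> ?b" if "x \<in> ?K" for x by (rule Max_ge) (use that in auto)
    with le have "Poly_Mapping.lookup p x \<le> ?b" if "x \<in> ?K" for x
      using that order_trans by blast
    moreover have "Poly_Mapping.lookup p x = 0" if "x \<notin> ?K" for x
      using that le[of x] by (simp add: in_keys_iff)
    ultimately show ?thesis by simp
  qed
  have "Poly_Mapping.lookup ` {p. \<exists>q. p + q = m} \<subseteq> ?F"
    by (rule image_subsetI) (use low in \<open>unfold mem_Collect_eq, elim exE\<close>)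
  then have "finite (Poly_Mapping.lookup ` {p. \<exists>q. p + q = m})"
    using finF by (rule finite_subset)
  moreover have "inj_on Poly_Mapping.lookup {p. \<exists>q. p + q = m}"
    by (rule inj_onI) (simp add: lookup_inject)
  ultimately have "finite {p. \<exists>q. p + q = m}"
    by (rule finite_imageD)
  moreover have "{(p, q). p + q = m} \<subseteq> {p. \<exists>q. p + q = m} \<times> {p. \<exists>q. p + q = m}"
    by auto (metis add.commute)
  ultimately show ?thesis by (meson finite_SigmaI finite_subset)
qed

definition tensor_mult :: "fock_series \<Rightarrow> fock_series \<Rightarrow> tensor_series" where
  "tensor_mult f g m S T = (\<Sum>(p, q) | p + q = m. f p S * g q T)"

text \<open>This is \<open>\<Gamma> \<otimes> 1 + 1 \<otimes> \<Gamma>\<close>, defined on arbitrary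
  series of tensors so that it also applies to \<open>Omega\<close> of a product, which need not be
  a product.\<close>

definition Gamma2 :: "nat \<Rightarrow> nat \<Rightarrow> tensor_series \<Rightarrow> tensor_series" where
  "Gamma2 a b h m S T = (\<Sum>(k, l) | (a, b, k, l) \<in> Poly_Mapping.keys m.
     hop2 (a, - k - 1) (b, l) (h (m - Poly_Mapping.single (a, b, k, l) 1)) S T)"

lemma finite_modes: "finite {(k, l). (a, b, k, l) \<in> Poly_Mapping.keys (m :: expo)}"
proof -
  have "inj (\<lambda>(k, l). (a, b, k, l))" by (auto simp: inj_def)
  then have "finite ((\<lambda>(k, l). (a, b, k, l)) -` Poly_Mapping.keys m)"
    by (rule finite_vimageI[rotated]) simp
  then show ?thesis by (simp add: vimage_def case_prod_unfold)
qed

lemma Gamma_apply: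
  "Gamma a b f m S = (\<Sum>(k, l) | (a, b, k, l) \<in> Poly_Mapping.keys m.
     hop (a, - k - 1) (b, l) (f (m - Poly_Mapping.single (a, b, k, l) 1)) S)"
  unfolding Gamma_def sum_fock_apply by (simp add: psi_def hop_def case_prod_unfold)

lemma single_minus_plus:
  "x \<in> Poly_Mapping.keys m \<Longrightarrow> m - Poly_Mapping.single x 1 + Poly_Mapping.single x 1 = (m :: expo)"
  by (rule poly_mapping_eqI) (auto simp: lookup_add lookup_minus lookup_single when_def in_keys_iff)

lemma plus_single_minus: "m + Poly_Mapping.single x 1 - Poly_Mapping.single x 1 = (m :: expo)"
  by (rule poly_mapping_eqI) (auto simp: lookup_add lookup_minus)

lemma keys_plus_single: "x \<in> Poly_Mapping.keys (m + Poly_Mapping.single x 1 :: expo)"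
  by (simp add: in_keys_iff lookup_add)

text \<open>Multiplying the first factor of a Cauchy product by a variable multiplies the product by
  it. On exponents, \<open>(p, q, i)\<close> corresponds to \<open>(i, p - e i, q)\<close>.
  Subtraction is truncated, so the conditions on keys are what make the two passages inverse to each
  other.\<close>

lemma sum_decompositions_shift:
  fixes a b :: nat and F :: "int \<times> int \<Rightarrow> expo \<Rightarrow> expo \<Rightarrow> complex"
  defines "e \<equiv> \<lambda>i. Poly_Mapping.single (a, b, fst i, snd i) (1 :: nat)"
  shows "(\<Sum>(p, q) | p + q = m. \<Sum>i | (a, b, fst i, snd i) \<in> Poly_Mapping.keys p. F i (p - e i) q) =
    (\<Sum>i | (a, b, fst i, snd i) \<in> Poly_Mapping.keys m. \<Sum>(p, q) | p + q = m - e i. F i p q)"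
proof -
  let ?K = "\<lambda>m::expo. {i. (a, b, fst i, snd i) \<in> Poly_Mapping.keys m}"
  have finK: "finite (?K m)" for m
    using finite_modes[of a b m] by (simp add: case_prod_unfold)
  have finD: "finite {(p, q). p + q = (m :: expo)}" for m
    by (rule finite_decompositions)
  have "(\<Sum>(p, q) | p + q = m. \<Sum>i\<in>?K p. F i (p - e i) q) =
      (\<Sum>((p, q), i)\<in>Sigma {(p, q). p + q = m} (\<lambda>(p, q). ?K p). F i (p - e i) q)"
    by (subst sum.Sigma[symmetric, OF finD]) (use finK in \<open>auto simp: case_prod_unfold\<close>)
  also have "\<dots> = (\<Sum>(i, p, q)\<in>Sigma (?K m) (\<lambda>i. {(p, q). p + q = m - e i}). F i p q)"
  proof (rule sum.reindex_bij_witness[of _ "\<lambda>(i, p, q). ((p + e i, q), i)" "\<lambda>((p, q), i). (i, p - e i, q)"], goal_cases)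
    case (1 x)
    then show ?case by (auto simp: e_def single_minus_plus simp del: One_nat_def)
  next
    case (2 x)
    then obtain p q i where x: "x = ((p, q), i)" "p + q = m" "i \<in> ?K p" by auto
    have "p = (p - e i) + e i" using x by (simp add: e_def single_minus_plus del: One_nat_def)
    then have "m = (p - e i) + q + e i" using x(2) by (metis add.assoc add.commute)
    then have "p - e i + q = m - e i" "i \<in> ?K m"
      using plus_single_minus keys_plus_single unfolding e_def mem_Collect_eq by metis+
    then show ?case using x by auto
  next
    case (3 x)
    then show ?case by (auto simp: e_def plus_single_minus simp del: One_nat_def)
  next
    case (4 x)
    then obtain p q i where x: "x = (i, p, q)" "p + q = m - e i" "i \<in> ?K m" by auto
    have "p + e i + q = (p + q) + e i" by (simp add: add_ac)
    also have "\<dots> = m" using x by (simp add: e_def single_minus_plus del: One_nat_def)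
    finally show ?case using x keys_plus_single by (auto simp: e_def simp del: One_nat_def)
  next
    case (5 x)
    then show ?case by auto
  qed
  also have "\<dots> = (\<Sum>i\<in>?K m. \<Sum>(p, q) | p + q = m - e i. F i p q)"
    by (subst sum.Sigma[symmetric, OF finK]) (use finD in \<open>auto simp: case_prod_unfold\<close>)
  finally show ?thesis .
qed

lemma tensor_mult_swap: "tensor_mult f g m S T = tensor_mult g f m T S"
  unfolding tensor_mult_def
  by (rule sum.reindex_bij_witness[of _ prod.swap prod.swap]) (auto simp: add.commute)

lemma tensor_mult_Gamma:
  "tensor_mult (Gamma a b f) g m S T = (\<Sum>(k, l) | (a, b, k, l) \<in> Poly_Mapping.keys m.
     hop (a, - k - 1) (b, l) (\<lambda>S'. tensor_mult f g (m - Poly_Mapping.single (a, b, k, l) 1) S' T) S)"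
proof -
  have "tensor_mult (Gamma a b f) g m S T =
     (\<Sum>(p, q) | p + q = m. \<Sum>i | (a, b, fst i, snd i) \<in> Poly_Mapping.keys p.
        hop (a, - fst i - 1) (b, snd i) (f (p - Poly_Mapping.single (a, b, fst i, snd i) 1)) S * g q T)"
    by (simp add: tensor_mult_def Gamma_apply sum_distrib_right case_prod_unfold)
  also have "\<dots> = (\<Sum>i | (a, b, fst i, snd i) \<in> Poly_Mapping.keys m. \<Sum>(p, q) | p + q = m - Poly_Mapping.single (a, b, fst i, snd i) 1.
        hop (a, - fst i - 1) (b, snd i) (f p) S * g q T)"
    by (rule sum_decompositions_shift)
  also have "\<dots> = (\<Sum>i | (a, b, fst i, snd i) \<in> Poly_Mapping.keys m.
     hop (a, - fst i - 1) (b, snd i) (\<lambda>S'. tensor_mult f g (m - Poly_Mapping.single (a, b, fst i, snd i) 1) S' T) S)"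
    by (simp add: tensor_mult_def case_prod_unfold hop_linear)
  finally show ?thesis by (simp add: case_prod_unfold)
qed

lemma Gamma2_tensor_mult:
  "Gamma2 a b (tensor_mult f g) m S T = tensor_mult (Gamma a b f) g m S T + tensor_mult f (Gamma a b g) m S T"
  unfolding tensor_mult_swap[of f "Gamma a b g"] tensor_mult_Gamma Gamma2_def hop2_def
  by (simp add: case_prod_unfold sum.distrib tensor_mult_swap[of g f])

lemma Gamma2_linear:
  "Gamma2 a b (\<lambda>m S T. \<Sum>i\<in>A. c i * h i m S T) m S T = (\<Sum>i\<in>A. c i * Gamma2 a b (h i) m S T)"
  unfolding Gamma2_def hop2_def case_prod_unfold hop_linear sum_distrib_left
  by (subst sum.swap) (simp add: sum.distrib algebra_simps)

lemma Gamma2_power_linear: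
  "(Gamma2 a b ^^ K) (\<lambda>m S T. \<Sum>i\<in>A. c i * h i m S T) = (\<lambda>m S T. \<Sum>i\<in>A. c i * (Gamma2 a b ^^ K) (h i) m S T)"
proof (induction K)
  case (Suc K)
  then show ?case by (simp add: Gamma2_linear[abs_def])
qed simp

text \<open>The binomial theorem for the commuting operators \<open>\<Gamma> \<otimes> 1\<close> and
  \<open>1 \<otimes> \<Gamma>\<close>. The induction applies the Leibniz rule and then Pascal's
  recursion.\<close>

lemma Gamma2_power_tensor_mult:
  "(Gamma2 a b ^^ K) (tensor_mult f g) m S T =
     (\<Sum>i\<le>K. of_nat (K choose i) * tensor_mult ((Gamma a b ^^ i) f) ((Gamma a b ^^ (K - i)) g) m S T)"
proof (induction K arbitrary: m S T)
  case (Suc K)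
  let ?t = "\<lambda>i j. tensor_mult ((Gamma a b ^^ i) f) ((Gamma a b ^^ j) g) m S T"
  have "(Gamma2 a b ^^ K) (tensor_mult f g) = (\<lambda>m S T. \<Sum>i\<le>K. of_nat (K choose i) * tensor_mult ((Gamma a b ^^ i) f) ((Gamma a b ^^ (K - i)) g) m S T)"
    using Suc by (simp add: fun_eq_iff)
  then have "(Gamma2 a b ^^ Suc K) (tensor_mult f g) m S T =
      (\<Sum>i\<le>K. of_nat (K choose i) * (?t (Suc i) (K - i) + ?t i (Suc (K - i))))"
    by (simp add: Gamma2_linear Gamma2_tensor_mult)
  also have "\<dots> = (\<Sum>i\<le>K. of_nat (K choose i) * ?t (Suc i) (K - i)) +
      (\<Sum>i\<le>K. of_nat (K choose i) * ?t i (Suc K - i))"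
    by (simp add: algebra_simps sum.distrib Suc_diff_le)
  \<comment> \<open>The added term \<open>i = Suc K\<close> carries a vanishing binomial
    coefficient. It gives both sums the same range after the shift of index.\<close>
  also have "(\<Sum>i\<le>K. of_nat (K choose i) * ?t i (Suc K - i)) = (\<Sum>i\<le>Suc K. of_nat (K choose i) * ?t i (Suc K - i))"
    by simp
  also have "\<dots> = ?t 0 (Suc K) + (\<Sum>i\<le>K. of_nat (K choose Suc i) * ?t (Suc i) (K - i))"
    by (subst sum.atMost_Suc_shift) simp
  also have "(\<Sum>i\<le>K. of_nat (K choose i) * ?t (Suc i) (K - i)) +
     (?t 0 (Suc K) + (\<Sum>i\<le>K. of_nat (K choose Suc i) * ?t (Suc i) (K - i))) =
     ?t 0 (Suc K) + (\<Sum>i\<le>K. of_nat (Suc K choose Suc i) * ?t (Suc i) (K - i))"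
    by (simp add: algebra_simps sum.distrib)
  also have "\<dots> = (\<Sum>i\<le>Suc K. of_nat (Suc K choose i) * ?t i (Suc K - i))"
    by (subst sum.atMost_Suc_shift) simp
  finally show ?case .
qed simp

text \<open>\<open>Omega\<close> commutes with hops only at pairs of semi-infinite sets, so equality
  is weakened to such pairs.\<close>

definition agree :: "nat \<Rightarrow> tensor_series \<Rightarrow> tensor_series \<Rightarrow> bool" where
  "agree n h h' \<longleftrightarrow> (\<forall>m S T. semi_infinite n S \<longrightarrow> semi_infinite n T \<longrightarrow> h m S T = h' m S T)"

text \<open>A coefficient of \<open>Gamma2\<close> at \<open>(S, T)\<close> involves only pairs in
  which one set has lost a site and gained a site of a colour below \<open>n\<close>. These are
  again semi-infinite, so the weakened equality survives iteration.\<close>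

lemma Gamma2_agree:
  assumes "agree n h h'" "a < n" "b < n"
  shows "agree n (Gamma2 a b h) (Gamma2 a b h')"
  unfolding agree_def Gamma2_def hop2_def
proof (intro allI impI sum.cong refl)
  fix m S T and x :: "int \<times> int"
  assume S: "semi_infinite n S" "semi_infinite n T"
  have "semi_infinite n (insert (b, l) (S - {u}))" "semi_infinite n (insert (b, l) (T - {u}))" for l u
    using S assms by (auto intro!: semi_infinite_insert semi_infinite_remove)
  then show "(case x of (k, l) \<Rightarrow> hop (a, - k - 1) (b, l) (\<lambda>S'. h (m - Poly_Mapping.single (a, b, k, l) 1) S' T) S +
        hop (a, - k - 1) (b, l) (h (m - Poly_Mapping.single (a, b, k, l) 1) S) T) =
    (case x of (k, l) \<Rightarrow> hop (a, - k - 1) (b, l) (\<lambda>S'. h' (m - Poly_Mapping.single (a, b, k, l) 1) S' T) S +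
        hop (a, - k - 1) (b, l) (h' (m - Poly_Mapping.single (a, b, k, l) 1) S) T)"
    using assms(1) S unfolding agree_def
    by (cases x) (simp cong: hop_cong)
qed

lemma agree_refl: "agree n h h"
  by (simp add: agree_def)

lemma agree_trans: "agree n h h' \<Longrightarrow> agree n h' h'' \<Longrightarrow> agree n h h''"
  by (simp add: agree_def)

lemma Gamma2_power_agree:
  "agree n h h' \<Longrightarrow> a < n \<Longrightarrow> b < n \<Longrightarrow> agree n ((Gamma2 a b ^^ K) h) ((Gamma2 a b ^^ K) h')"
  by (induction K) (auto intro: Gamma2_agree)

lemma Omega_Gamma2: "agree n (\<lambda>m. Omega (Gamma2 a b h m)) (Gamma2 a b (\<lambda>m. Omega (h m)))"
  unfolding agree_def
proof (intro allI impI)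
  fix m S T
  assume "semi_infinite n S" "semi_infinite n T"
  then show "Omega (Gamma2 a b h m) S T = Gamma2 a b (\<lambda>m. Omega (h m)) m S T"
    unfolding Gamma2_def[abs_def] case_prod_unfold Omega_linear by (simp add: Omega_hop2)
qed

lemma Omega_Gamma2_power:
  assumes "a < n" "b < n"
  shows "agree n (\<lambda>m. Omega ((Gamma2 a b ^^ K) h m)) ((Gamma2 a b ^^ K) (\<lambda>m. Omega (h m)))"
proof (induction K)
  case (Suc K)
  then show ?case
    using agree_trans[OF Omega_Gamma2 Gamma2_agree[OF Suc assms]] by simp
qed (simp add: agree_refl)

section \<open>Exponentials and the group element\<close>

lemma total_degree_superset:
  "finite A \<Longrightarrow> Poly_Mapping.keys m \<subseteq> A \<Longrightarrow> total_degree m = (\<Sum>x\<in>A. Poly_Mapping.lookup m x)"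
  unfolding total_degree_def by (rule sum.mono_neutral_left) (auto simp: in_keys_iff)

lemma total_degree_plus: "total_degree (p + q) = total_degree p + total_degree q"
proof -
  let ?A = "Poly_Mapping.keys p \<union> Poly_Mapping.keys q"
  have "total_degree (p + q) = (\<Sum>x\<in>?A. Poly_Mapping.lookup (p + q) x)"
    by (rule total_degree_superset[OF _ Poly_Mapping.keys_add]) simp
  moreover have "total_degree p = (\<Sum>x\<in>?A. Poly_Mapping.lookup p x)"
    "total_degree q = (\<Sum>x\<in>?A. Poly_Mapping.lookup q x)"
    by (rule total_degree_superset; auto)+
  ultimately show ?thesis by (simp add: lookup_add sum.distrib)
qed

lemma hop_zero [simp]: "hop x y 0 = 0"
  by (auto simp: hop_def wedge_def contract_def)

lemma Gamma_power_vanishes: "total_degree m < N \<Longrightarrow> (Gamma a b ^^ N) f m = 0"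
proof (induction N arbitrary: m)
  case (Suc N)
  have "(Gamma a b ^^ N) f (m - Poly_Mapping.single (a, b, k, l) 1) = 0"
    if "(a, b, k, l) \<in> Poly_Mapping.keys m" for k l
  proof (rule Suc.IH)
    have "total_degree m = total_degree (m - Poly_Mapping.single (a, b, k, l) 1) + total_degree (Poly_Mapping.single (a, b, k, l) 1)"
      using that by (metis single_minus_plus total_degree_plus)
    moreover have "total_degree (Poly_Mapping.single (a, b, k, l) 1) = 1"
      by (simp add: total_degree_def)
    ultimately show "total_degree (m - Poly_Mapping.single (a, b, k, l) 1) < N"
      using Suc.prems by simp
  qed
  then have "Gamma a b ((Gamma a b ^^ N) f) m S = 0" for S
    unfolding Gamma_apply by (intro sum.neutral) (auto simp del: One_nat_def)
  then show ?case by (simp add: fun_eq_iff)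
qed simp

text \<open>The exponential is truncated at the degree of its own exponent. In a product the
  exponents \<open>p\<close> and \<open>q\<close> have different degrees, so a common bound is
  needed; the extra powers vanish, each \<open>\<Gamma>\<close> using up one variable.\<close>

lemma exp_Gamma_superset:
  assumes "total_degree m \<le> L"
  shows "exp_Gamma a b f m S = (\<Sum>N\<le>L. (Gamma a b ^^ N) f m S / fact N)"
  unfolding exp_Gamma_def sum_fock_apply
  by (rule sum.mono_neutral_cong_left) (use assms in \<open>auto simp: scale_def Gamma_power_vanishes\<close>)

text \<open>This is \<open>exp \<Gamma> \<otimes> exp \<Gamma> = exp (\<Gamma> \<otimes> 1 + 1
  \<otimes> \<Gamma>)\<close>, with the exponential on the right truncated at the total
  degree.\<close>

lemma tensor_mult_exp_Gamma:
  "tensor_mult (exp_Gamma a b f) (exp_Gamma a b g) m S T =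
    (\<Sum>K\<le>total_degree m. 1 / fact K * (Gamma2 a b ^^ K) (tensor_mult f g) m S T)"
proof -
  let ?d = "total_degree m"
  let ?t = "\<lambda>i j. tensor_mult ((Gamma a b ^^ i) f) ((Gamma a b ^^ j) g) m S T"
  have "tensor_mult (exp_Gamma a b f) (exp_Gamma a b g) m S T =
    (\<Sum>(p, q) | p + q = m. (\<Sum>N\<le>?d. (Gamma a b ^^ N) f p S / fact N) * (\<Sum>M\<le>?d. (Gamma a b ^^ M) g q T / fact M))"
    unfolding tensor_mult_def
    by (intro sum.cong refl) (auto simp: total_degree_plus exp_Gamma_superset[symmetric])
  also have "\<dots> = (\<Sum>(p, q) | p + q = m. \<Sum>(N, M)\<in>{..?d} \<times> {..?d}. (Gamma a b ^^ N) f p S * (Gamma a b ^^ M) g q T / (fact N * fact M))"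
    by (simp add: sum_product sum.cartesian_product case_prod_unfold)
  also have "\<dots> = (\<Sum>(N, M)\<in>{..?d} \<times> {..?d}. ?t N M / (fact N * fact M))"
    unfolding tensor_mult_def by (simp add: case_prod_unfold sum_divide_distrib) (rule sum.swap)
  \<comment> \<open>If \<open>N + M\<close> exceeds the degree of \<open>p + q\<close>, then
    \<open>N\<close> exceeds that of \<open>p\<close> or \<open>M\<close> that of \<open>q\<close>,
    and one factor vanishes. The remaining triangle can be summed along
    \<open>N + M = K\<close>.\<close>
  also have "\<dots> = (\<Sum>(N, M) | N + M \<le> ?d. ?t N M / (fact N * fact M))"
  proof (rule sum.mono_neutral_right)
    show "\<forall>x\<in>{..?d} \<times> {..?d} - {(N, M). N + M \<le> ?d}. (case x of (N, M) \<Rightarrow> ?t N M / (fact N * fact M)) = 0"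
    proof
      fix x assume "x \<in> {..?d} \<times> {..?d} - {(N, M). N + M \<le> ?d}"
      then obtain N M where x: "x = (N, M)" and "\<not> N + M \<le> ?d" by auto
      then have "total_degree p < N \<or> total_degree q < M" if "p + q = m" for p q
        using that by (auto simp: total_degree_plus)
      then have "(Gamma a b ^^ N) f p S * (Gamma a b ^^ M) g q T = 0" if "p + q = m" for p q
        using that by (metis Gamma_power_vanishes mult_eq_0_iff zero_fun_apply)
      then have "?t N M = 0"
        unfolding tensor_mult_def by (intro sum.neutral) auto
      then show "(case x of (N, M) \<Rightarrow> ?t N M / (fact N * fact M)) = 0" using x by simp
    qed
  qed auto
  also have "\<dots> = (\<Sum>K\<le>?d. \<Sum>i\<le>K. ?t i (K - i) / (fact i * fact (K - i)))"
    by (rule sum.triangle_reindex_eq)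
  also have "\<dots> = (\<Sum>K\<le>?d. 1 / fact K * (Gamma2 a b ^^ K) (tensor_mult f g) m S T)"
    unfolding Gamma2_power_tensor_mult
    by (intro sum.cong refl) (auto simp: sum_distrib_left binomial_fact intro!: sum.cong)
  finally show ?thesis .
qed

text \<open>The inductive step for one factor of \<open>g\<close>. A finite linear combination of
  products keeps its shape when \<open>exp \<Gamma> \<otimes> exp \<Gamma>\<close> is applied,
  because that operator is an exponential of the linear operator \<open>Gamma2\<close>.\<close>

lemma Omega_exp_Gamma:
  assumes "agree n (\<lambda>m. Omega (tensor_mult f g m)) (\<lambda>m S T. \<Sum>i\<in>A. c i * tensor_mult (f' i) (g' i) m S T)"
    and "a < n" "b < n"
  shows "agree n (\<lambda>m. Omega (tensor_mult (exp_Gamma a b f) (exp_Gamma a b g) m))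
    (\<lambda>m S T. \<Sum>i\<in>A. c i * tensor_mult (exp_Gamma a b (f' i)) (exp_Gamma a b (g' i)) m S T)"
  unfolding agree_def
proof (intro allI impI)
  fix m S T
  assume S: "semi_infinite n S" "semi_infinite n T"
  let ?d = "total_degree m"
  have "Omega (tensor_mult (exp_Gamma a b f) (exp_Gamma a b g) m) S T =
     (\<Sum>K\<le>?d. 1 / fact K * Omega ((Gamma2 a b ^^ K) (tensor_mult f g) m) S T)"
    unfolding tensor_mult_exp_Gamma[abs_def] Omega_linear ..
  also have "\<dots> = (\<Sum>K\<le>?d. 1 / fact K * (\<Sum>i\<in>A. c i * (Gamma2 a b ^^ K) (tensor_mult (f' i) (g' i)) m S T))"
  proof (intro sum.cong refl arg_cong2[of _ _ _ _ times])
    fix K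
    show "Omega ((Gamma2 a b ^^ K) (tensor_mult f g) m) S T =
      (\<Sum>i\<in>A. c i * (Gamma2 a b ^^ K) (tensor_mult (f' i) (g' i)) m S T)"
      using agree_trans[OF Omega_Gamma2_power[OF assms(2,3)] Gamma2_power_agree[OF assms]] S
      unfolding Gamma2_power_linear agree_def by blast
  qed
  also have "\<dots> = (\<Sum>i\<in>A. c i * tensor_mult (exp_Gamma a b (f' i)) (exp_Gamma a b (g' i)) m S T)"
    unfolding tensor_mult_exp_Gamma sum_distrib_left by (subst sum.swap) (simp add: mult_ac)
  finally show "Omega (tensor_mult (exp_Gamma a b f) (exp_Gamma a b g) m) S T = \<dots>" .
qed

lemma tensor_mult_const: "tensor_mult (const_series v) (const_series w) m S T = (if m = 0 then v S * w T else 0)"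
proof -
  have "tensor_mult (const_series v) (const_series w) m S T =
    (\<Sum>x\<in>{(p, q). p + q = m}. if x = (0, 0) then v S * w T else 0)"
    unfolding tensor_mult_def by (intro sum.cong refl) (auto simp: const_series_def split: if_splits)
  then show ?thesis by (simp add: finite_decompositions)
qed

lemma Omega_group_element:
  assumes vw: "\<And>S T. semi_infinite n S \<Longrightarrow> semi_infinite n T \<Longrightarrow>
     Omega (\<lambda>S T. v S * w T) S T = (\<Sum>i\<in>A. c i * (v' i S * w' i T))"
  shows "agree n (\<lambda>m. Omega (tensor_mult (group_element n v) (group_element n w) m))
    (\<lambda>m S T. \<Sum>i\<in>A. c i * tensor_mult (group_element n (v' i)) (group_element n (w' i)) m S T)"
proof -
  let ?G = "\<lambda>ps v. foldr (\<lambda>(a, b). exp_Gamma a b) ps (const_series v)"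
  have "agree n (\<lambda>m. Omega (tensor_mult (?G ps v) (?G ps w) m))
    (\<lambda>m S T. \<Sum>i\<in>A. c i * tensor_mult (?G ps (v' i)) (?G ps (w' i)) m S T)"
    if "\<forall>(a, b)\<in>set ps. a < n \<and> b < n" for ps
    using that
  proof (induction ps)
    case Nil
    have "Omega (tensor_mult (const_series v) (const_series w) m) S T =
        (if m = 0 then Omega (\<lambda>S T. v S * w T) S T else 0)" for m S T
      by (cases "m = 0") (simp_all add: tensor_mult_const[abs_def] Omega_def contract_linear wedge_linear)
    then show ?case using vw unfolding agree_def foldr.simps id_apply tensor_mult_const by simp
  next
    case (Cons p ps)
    then show ?case by (cases p) (auto intro: Omega_exp_Gamma)
  qed
  moreover have "\<forall>(a, b)\<in>set (ordered_pairs n). a < n \<and> b < n"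
    by (auto simp: ordered_pairs_def)
  ultimately show ?thesis unfolding group_element_def by blast
qed

section \<open>Translation operators\<close>

lemma Fock_add: "u \<in> Fock n \<Longrightarrow> v \<in> Fock n \<Longrightarrow> u + v \<in> Fock n"
proof -
  assume "u \<in> Fock n" "v \<in> Fock n"
  moreover have "{S. (u + v) S \<noteq> 0} \<subseteq> {S. u S \<noteq> 0} \<union> {S. v S \<noteq> 0}" by auto
  ultimately show ?thesis unfolding Fock_def by (auto intro: finite_subset)
qed

lemma Fock_zero: "0 \<in> Fock n"
  by (simp add: Fock_def)

lemma Fock_scale: "v \<in> Fock n \<Longrightarrow> scale c v \<in> Fock n"
  unfolding Fock_def by (auto simp: scale_def elim: rev_finite_subset)

lemma Fock_sum: "(\<And>i. i \<in> A \<Longrightarrow> f i \<in> Fock n) \<Longrightarrow> sum f A \<in> Fock n"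
  by (induction A rule: infinite_finite_induct) (auto intro: Fock_add Fock_zero simp del: plus_fun_apply)

lemma Fock_wedge:
  assumes "v \<in> Fock n" "fst x < n"
  shows "wedge x v \<in> Fock n"
proof -
  have sub: "{T. wedge x v T \<noteq> 0} \<subseteq> insert x ` {S. v S \<noteq> 0}"
  proof
    fix T assume "T \<in> {T. wedge x v T \<noteq> 0}"
    then have "x \<in> T" "v (T - {x}) \<noteq> 0" by (auto simp: wedge_def split: if_splits)
    then show "T \<in> insert x ` {S. v S \<noteq> 0}" by (intro image_eqI[of _ _ "T - {x}"]) auto
  qed
  moreover have "semi_infinite n T" if "wedge x v T \<noteq> 0" for T
    using sub that assms semi_infinite_insert unfolding Fock_def by blast
  ultimately show ?thesis using assms(1) unfolding Fock_def
    by (auto intro: finite_subset)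
qed

lemma Fock_contract:
  assumes "v \<in> Fock n"
  shows "contract x v \<in> Fock n"
proof -
  have sub: "{T. contract x v T \<noteq> 0} \<subseteq> (\<lambda>S. S - {x}) ` {S. v S \<noteq> 0}"
  proof
    fix T assume "T \<in> {T. contract x v T \<noteq> 0}"
    then have "x \<notin> T" "v (insert x T) \<noteq> 0" by (auto simp: contract_def split: if_splits)
    then show "T \<in> (\<lambda>S. S - {x}) ` {S. v S \<noteq> 0}" by (intro image_eqI[of _ _ "insert x T"]) auto
  qed
  moreover have "semi_infinite n T" if "contract x v T \<noteq> 0" for T
    using sub that assms semi_infinite_remove unfolding Fock_def by blast
  ultimately show ?thesis using assms(1) unfolding Fock_def
    by (auto intro: finite_subset)
qed

lemma monomial_Fock [simp]: "monomial S \<in> Fock n \<longleftrightarrow> semi_infinite n S"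
proof -
  have "{T. monomial S T \<noteq> 0} = {S}" by (auto simp: monomial_def)
  moreover have "monomial S T \<noteq> 0 \<longleftrightarrow> T = S" for T by (simp add: monomial_def)
  ultimately show ?thesis unfolding Fock_def by simp
qed

lemma semi_infinite_sea: "semi_infinite n (sea n)"
  by (auto simp: semi_infinite_def sea_def)

lemma vac_Fock: "vac n \<in> Fock n"
  by (simp add: vac_def semi_infinite_sea)

lemma scale_scale [simp]: "scale c (scale d v) = scale (c * d) v"
  by (simp add: scale_def mult.assoc)

lemma scale_one [simp]: "scale 1 v = v"
  by (simp add: scale_def)

lemma scale_0_left [simp]: "scale 0 v = 0"
  by (simp add: scale_def fun_eq_iff)

lemma scale_0_right [simp]: "scale c 0 = 0"
  by (simp add: scale_def fun_eq_iff)

lemma uminus_scale: "- v = scale (- 1) v"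
  by (simp add: scale_def fun_eq_iff)

lemma Fock_expansion:
  assumes "v \<in> Fock n"
  shows "v = (\<Sum>S | v S \<noteq> 0. scale (v S) (monomial S))"
proof
  fix T
  have "(\<Sum>S | v S \<noteq> 0. scale (v S) (monomial S)) T = (\<Sum>S | v S \<noteq> 0. if S = T then v T else 0)"
    unfolding sum_fock_apply by (rule sum.cong) (auto simp: scale_def monomial_def)
  also have "\<dots> = v T" using assms by (auto simp: Fock_def)
  finally show "v T = (\<Sum>S | v S \<noteq> 0. scale (v S) (monomial S)) T" by simp
qed

section \<open>Signed monomials and isometries of Fock space\<close>

definition signed_monomial :: "nat \<Rightarrow> fock \<Rightarrow> bool" where
  "signed_monomial n u \<longleftrightarrow>
     (\<exists>S c. semi_infinite n S \<and> (c = 1 \<or> c = - 1) \<and> u = scale c (monomial S))"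

lemma signed_monomial_Fock: "signed_monomial n u \<Longrightarrow> u \<in> Fock n"
  unfolding signed_monomial_def by (auto intro: Fock_scale)

lemma signed_monomial_vac: "signed_monomial n (vac n)"
  unfolding signed_monomial_def vac_def using semi_infinite_sea scale_one by metis

text \<open>With a multiple of a monomial on the left the form reads off one coefficient. It is then
  linear in the right argument without any finiteness condition, which is why signed monomials serve
  as bras.\<close>

lemma inner_scale_monomial: "inner (scale c (monomial S)) v = c * v S"
proof -
  have "inner (scale c (monomial S)) v = (\<Sum>T\<in>(if c = 0 \<or> v S = 0 then {} else {S}). c * v S)"
    unfolding inner_def by (rule sum.cong) (auto simp: scale_def monomial_def split: if_splits)
  then show ?thesis by auto
qed

lemma inner_zero_left [simp]: "inner 0 v = 0"
  by (simp add: inner_def)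

lemma inner_zero_right [simp]: "inner v 0 = 0"
  by (simp add: inner_def)

lemma inner_scale_left: "inner (scale c u) v = c * inner u v"
proof (cases "c = 0")
  case False
  then show ?thesis by (simp add: inner_def scale_def sum_distrib_left mult.assoc)
qed simp

text \<open>Wedging and contraction by the same site are adjoint because both use the reordering
  sign of the set without that site.\<close>

lemma inner_wedge:
  assumes "signed_monomial n u"
  shows "inner u (wedge z f) = inner (contract z u) f"
proof -
  obtain S c where u: "u = scale c (monomial S)"
    using assms by (auto simp: signed_monomial_def)
  show ?thesis
  proof (cases "z \<in> S")
    case True
    then show ?thesis unfolding u contract_monomial[OF True] inner_scale_monomial by (simp add: wedge_def)
  next
    case False
    then have "contract z u = 0"
      by (auto simp: u contract_def scale_def monomial_def fun_eq_iff)
    then show ?thesis using False by (simp add: u inner_scale_monomial wedge_def)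
  qed
qed

lemma inner_contract:
  assumes "signed_monomial n u"
  shows "inner u (contract z f) = inner (wedge z u) f"
proof -
  obtain S c where u: "u = scale c (monomial S)"
    using assms by (auto simp: signed_monomial_def)
  show ?thesis
  proof (cases "z \<in> S")
    case False
    then show ?thesis unfolding u wedge_monomial[OF False] inner_scale_monomial by (simp add: contract_def)
  next
    case True
    then have "wedge z u = 0"
      by (auto simp: u wedge_def scale_def monomial_def fun_eq_iff)
    then show ?thesis using True by (simp add: u inner_scale_monomial contract_def)
  qed
qed

definition parity_sign :: "int \<Rightarrow> complex" where
  "parity_sign k = (if even k then 1 else - 1)"

lemma parity_sign_add: "parity_sign (k + l) = parity_sign k * parity_sign l"
  by (auto simp: parity_sign_def)

lemma parity_sign_minus [simp]: "parity_sign (- k) = parity_sign k"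
  by (auto simp: parity_sign_def)

lemma parity_sign_square [simp]: "parity_sign k * parity_sign k = 1"
  by (auto simp: parity_sign_def)

lemma parity_sign_0 [simp]: "parity_sign 0 = 1"
  by (auto simp: parity_sign_def)

text \<open>The properties required of \<open>Q^\<beta>\<close>, chosen so that they pass to
  composites and inverses. The last condition is the isometry property, restricted on the left to
  bras.\<close>

definition fock_auto :: "nat \<Rightarrow> (fock \<Rightarrow> fock) \<Rightarrow> bool" where
  "fock_auto n f \<longleftrightarrow> bij_betw f (Fock n) (Fock n) \<and>
     (\<forall>c. \<forall>v\<in>Fock n. f (scale c v) = scale c (f v)) \<and>
     (\<forall>u. signed_monomial n u \<longrightarrow> signed_monomial n (f u)) \<and>
     (\<forall>u. signed_monomial n u \<longrightarrow> signed_monomial n (inv_into (Fock n) f u)) \<and>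
     (\<forall>u v. signed_monomial n u \<longrightarrow> v \<in> Fock n \<longrightarrow> inner (f u) (f v) = inner u v)"

lemma
  assumes "fock_auto n f"
  shows fock_auto_closed: "v \<in> Fock n \<Longrightarrow> f v \<in> Fock n"
    and fock_auto_inv_closed: "v \<in> Fock n \<Longrightarrow> inv_into (Fock n) f v \<in> Fock n"
    and fock_auto_inv_left: "v \<in> Fock n \<Longrightarrow> inv_into (Fock n) f (f v) = v"
    and fock_auto_inv_right: "v \<in> Fock n \<Longrightarrow> f (inv_into (Fock n) f v) = v"
    and fock_auto_scale: "v \<in> Fock n \<Longrightarrow> f (scale c v) = scale c (f v)"
    and fock_auto_signed_monomial: "signed_monomial n u \<Longrightarrow> signed_monomial n (f u)"
    and fock_auto_inner: "signed_monomial n u \<Longrightarrow> v \<in> Fock n \<Longrightarrow> inner (f u) (f v) = inner u v"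
  using assms unfolding fock_auto_def
  by (auto simp: bij_betw_inv_into_left bij_betw_inv_into_right bij_betw_apply
      bij_betw_apply[OF bij_betw_inv_into])

lemma fock_auto_zero: "fock_auto n f \<Longrightarrow> f 0 = 0"
  using fock_auto_scale[of n f 0 0] by (simp add: Fock_zero)

lemma fock_auto_inv_eq: "fock_auto n f \<Longrightarrow> v \<in> Fock n \<Longrightarrow> f v = w \<Longrightarrow> inv_into (Fock n) f w = v"
  using fock_auto_inv_left by blast

lemma fock_auto_inv:
  assumes f: "fock_auto n f"
  shows "fock_auto n (inv_into (Fock n) f)"
  unfolding fock_auto_def
proof (intro conjI allI ballI impI)
  let ?g = "inv_into (Fock n) f"
  note rules = f fock_auto_closed[OF f] fock_auto_inv_closed[OF f] fock_auto_inv_left[OF f]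
    fock_auto_inv_right[OF f] signed_monomial_Fock
  show bij: "bij_betw ?g (Fock n) (Fock n)"
    using f by (simp add: fock_auto_def bij_betw_inv_into)
  fix c u v
  show "?g (scale c v) = scale c (?g v)" if "v \<in> Fock n"
    using that by (intro fock_auto_inv_eq) (auto simp: rules fock_auto_scale[OF f] Fock_scale)
  show *: "signed_monomial n (?g u)" if "signed_monomial n u"
    using f that by (simp add: fock_auto_def)
  show "signed_monomial n (inv_into (Fock n) ?g u)" if "signed_monomial n u"
  proof -
    have "inv_into (Fock n) ?g u = f u"
      using inv_into_f_eq[of ?g "Fock n" "f u" u] bij that rules by (auto simp: bij_betw_def)
    then show ?thesis using fock_auto_signed_monomial[OF f that] by simp
  qed
  show "inner (?g u) (?g v) = inner u v" if "signed_monomial n u" "v \<in> Fock n"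
    using fock_auto_inner[OF f *, of "?g v"] that by (simp add: rules)
qed

lemma fock_auto_comp:
  assumes f: "fock_auto n f" and g: "fock_auto n g"
  shows "fock_auto n (f \<circ> g)"
  unfolding fock_auto_def
proof (intro conjI allI ballI impI)
  show bij: "bij_betw (f \<circ> g) (Fock n) (Fock n)"
    using f g by (auto simp: fock_auto_def intro: bij_betw_trans)
  fix c u v
  show "(f \<circ> g) (scale c v) = scale c ((f \<circ> g) v)" if "v \<in> Fock n"
    using that f g by (simp add: fock_auto_scale fock_auto_closed)
  show "signed_monomial n ((f \<circ> g) u)" if "signed_monomial n u"
    using that f g by (simp add: fock_auto_signed_monomial)
  show "signed_monomial n (inv_into (Fock n) (f \<circ> g) u)" if "signed_monomial n u"
  proof -
    have "inv_into (Fock n) (f \<circ> g) u = inv_into (Fock n) g (inv_into (Fock n) f u)"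
      using inv_into_f_eq[of "f \<circ> g" "Fock n" "inv_into (Fock n) g (inv_into (Fock n) f u)" u]
        bij signed_monomial_Fock[OF that] f g
      by (auto simp: bij_betw_def fock_auto_inv_closed fock_auto_inv_right)
    then show ?thesis using f g that by (simp add: fock_auto_def)
  qed
  show "inner ((f \<circ> g) u) ((f \<circ> g) v) = inner u v" if "signed_monomial n u" "v \<in> Fock n"
    using that f g by (simp add: fock_auto_inner fock_auto_signed_monomial fock_auto_closed)
qed

lemma fock_auto_id: "fock_auto n id"
proof -
  have "inv_into (Fock n) id u = u" if "signed_monomial n u" for u
    by (rule inv_into_f_eq) (use signed_monomial_Fock[OF that] in auto)
  then show ?thesis by (simp add: fock_auto_def)
qed

lemma fock_auto_power: "fock_auto n f \<Longrightarrow> fock_auto n (f ^^ m)"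
  by (induction m) (auto intro: fock_auto_comp simp: fock_auto_id[unfolded id_def] fock_auto_id)

text \<open>Two operators \<open>A\<close> and \<open>A'\<close> are allowed because moving a
  fermion past a translation operator of its own colour shifts its mode. Past the other colours it
  only produces the scalar.\<close>

definition intertwines :: "nat \<Rightarrow> (fock \<Rightarrow> fock) \<Rightarrow> complex \<Rightarrow> (fock \<Rightarrow> fock) \<Rightarrow> (fock \<Rightarrow> fock) \<Rightarrow> bool" where
  "intertwines n A s f A' \<longleftrightarrow> (\<forall>v\<in>Fock n. A (f v) = scale s (f (A' v)))"

lemma intertwines_comp:
  assumes "intertwines n A s f A'" "intertwines n A' t g A''" "fock_auto n f" "fock_auto n g"
    and "\<And>v. v \<in> Fock n \<Longrightarrow> A'' v \<in> Fock n"
  shows "intertwines n A (s * t) (f \<circ> g) A''"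
  using assms by (auto simp: intertwines_def fock_auto_closed fock_auto_scale)

lemma intertwines_id: "intertwines n A 1 id A"
  by (simp add: intertwines_def)

lemma intertwines_inv:
  assumes "intertwines n A s f A'" "fock_auto n f" "s * s = 1"
    and "\<And>v. v \<in> Fock n \<Longrightarrow> A' v \<in> Fock n"
  shows "intertwines n A' s (inv_into (Fock n) f) A"
  unfolding intertwines_def
proof
  fix v assume v: "v \<in> Fock n"
  let ?g = "inv_into (Fock n) f"
  have w: "?g v \<in> Fock n" using assms(2) v by (rule fock_auto_inv_closed)
  have "A v = scale s (f (A' (?g v)))"
    using assms(1) w fock_auto_inv_right[OF assms(2) v] by (auto simp: intertwines_def)
  also have "\<dots> = f (scale s (A' (?g v)))"
    using assms w by (simp add: fock_auto_scale)
  finally have "?g (A v) = scale s (A' (?g v))"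
    using assms w by (simp add: fock_auto_inv_left Fock_scale)
  then show "A' (?g v) = scale s (?g (A v))" using assms(3) by simp
qed

section \<open>Translation operators on monomials\<close>

locale translation_system =
  fixes n :: nat and Q :: "nat \<Rightarrow> fock \<Rightarrow> fock"
  assumes trans: "translation_operators n Q"
begin

lemma Q_add: "a < n \<Longrightarrow> u \<in> Fock n \<Longrightarrow> v \<in> Fock n \<Longrightarrow> Q a (u + v) = Q a u + Q a v"
  and Q_scale: "a < n \<Longrightarrow> v \<in> Fock n \<Longrightarrow> Q a (scale c v) = scale c (Q a v)"
  and Q_bij: "a < n \<Longrightarrow> bij_betw (Q a) (Fock n) (Fock n)"
  using trans unfolding translation_operators_def by blast+

lemma Q_vac: "a < n \<Longrightarrow> Q a (vac n) = wedge (a, - 1) (vac n)"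
proof -
  assume "a < n"
  then have "Q a (vac n) = psi 1 a (- 1) (vac n)"
    using trans unfolding translation_operators_def by blast
  then show ?thesis by (simp add: psi_def)
qed

lemma Q_inv_vac: "a < n \<Longrightarrow> inv_into (Fock n) (Q a) (vac n) = contract (a, 0) (vac n)"
proof -
  assume "a < n"
  then have "inv_into (Fock n) (Q a) (vac n) = psi (- 1) a (- 1) (vac n)"
    using trans unfolding translation_operators_def by blast
  then show ?thesis by (simp add: psi_def)
qed

lemma Q_anticommute: "a < n \<Longrightarrow> c < n \<Longrightarrow> c \<noteq> a \<Longrightarrow> intertwines n (Q c) (- 1) (Q a) (Q c)"
  using trans unfolding translation_operators_def intertwines_def uminus_scale[symmetric] by blast

lemma Q_wedge:
  assumes "a < n" "c < n"
  shows "intertwines n (wedge (a, k)) 1 (Q a) (wedge (a, k + 1))"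
    and "c \<noteq> a \<Longrightarrow> intertwines n (wedge (c, k)) (- 1) (Q a) (wedge (c, k))"
proof -
  \<comment> \<open>The coefficient of \<open>z^j\<close> in the field is the mode
    \<open>- j - 1\<close>, so \<open>j = - k - 1\<close> selects \<open>wedge (a, k)\<close>;
    lowering \<open>j\<close> by one raises the mode to \<open>k + 1\<close>.\<close>
  have "\<forall>v\<in>Fock n. field_coeff 1 a (- k - 1) (Q a v) = Q a (field_coeff 1 a (- k - 1 - 1) v)"
    using trans assms unfolding translation_operators_def by blast
  then show "intertwines n (wedge (a, k)) 1 (Q a) (wedge (a, k + 1))"
    by (simp add: intertwines_def field_coeff_def psi_def add.commute)
  assume "c \<noteq> a"
  then have "\<forall>v\<in>Fock n. field_coeff 1 c (- k - 1) (Q a v) = - Q a (field_coeff 1 c (- k - 1) v)"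
    using trans assms unfolding translation_operators_def by blast
  then show "intertwines n (wedge (c, k)) (- 1) (Q a) (wedge (c, k))"
    by (simp add: intertwines_def field_coeff_def psi_def uminus_scale[symmetric])
qed

lemma Q_contract:
  assumes "a < n" "c < n"
  shows "intertwines n (contract (a, k)) 1 (Q a) (contract (a, k + 1))"
    and "c \<noteq> a \<Longrightarrow> intertwines n (contract (c, k)) (- 1) (Q a) (contract (c, k))"
proof -
  \<comment> \<open>Here \<open>j = k\<close>: the mode \<open>- k - 1\<close> of the lower field
    contracts with the site \<open>(a, k)\<close>, and \<open>j - (- 1)\<close> gives
    \<open>(a, k + 1)\<close>.\<close>
  have "\<forall>v\<in>Fock n. field_coeff (- 1) a k (Q a v) = Q a (field_coeff (- 1) a (k - (- 1)) v)"
    using trans assms unfolding translation_operators_def by blast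
  then show "intertwines n (contract (a, k)) 1 (Q a) (contract (a, k + 1))"
    by (simp add: intertwines_def field_coeff_def psi_def add.commute)
  assume "c \<noteq> a"
  then have "\<forall>v\<in>Fock n. field_coeff (- 1) c k (Q a v) = - Q a (field_coeff (- 1) c k v)"
    using trans assms unfolding translation_operators_def by blast
  then show "intertwines n (contract (c, k)) (- 1) (Q a) (contract (c, k))"
    by (simp add: intertwines_def field_coeff_def psi_def uminus_scale[symmetric])
qed

lemma Q_closed: "a < n \<Longrightarrow> v \<in> Fock n \<Longrightarrow> Q a v \<in> Fock n"
  using Q_bij bij_betw_apply by metis

lemma Q_sum:
  assumes "a < n"
  shows "finite A \<Longrightarrow> (\<And>i. i \<in> A \<Longrightarrow> f i \<in> Fock n) \<Longrightarrow> Q a (\<Sum>i\<in>A. f i) = (\<Sum>i\<in>A. Q a (f i))"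
proof (induction A rule: finite_induct)
  case empty
  have "Q a 0 = 0" using Q_scale[OF assms Fock_zero, of 0] by simp
  then show ?case by (simp only: sum.empty)
next
  case (insert i A)
  then have "Q a (f i + sum f A) = Q a (f i) + Q a (sum f A)"
    by (intro Q_add assms Fock_sum) auto
  moreover have "Q a (sum f A) = (\<Sum>i\<in>A. Q a (f i))" using insert by blast
  ultimately show ?case by (simp only: sum.insert[OF insert(1,2)])
qed

text \<open>This is the change of site when an operator is moved to the right past
  \<open>Q a\<close>. Consequently \<open>Q a\<close> itself moves the sites of a monomial by
  \<open>unshift a\<close>, so monomials are transformed by preimages under
  \<open>shift a\<close>.\<close>

definition shift :: "nat \<Rightarrow> site \<Rightarrow> site" where
  "shift a z = (fst z, if fst z = a then snd z + 1 else snd z)"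

definition unshift :: "nat \<Rightarrow> site \<Rightarrow> site" where
  "unshift a z = (fst z, if fst z = a then snd z - 1 else snd z)"

lemma shift_unshift [simp]: "shift a (unshift a z) = z" "unshift a (shift a z) = z"
  by (auto simp: shift_def unshift_def)

lemma fst_unshift: "fst (unshift a z) = fst z"
  by (simp add: unshift_def)

lemma vimage_shift: "shift a -` S = unshift a ` S"
  by (auto simp: vimage_def) (metis shift_unshift(2) imageI)

lemma Q_wedge_shift:
  assumes "a < n" "fst z < n"
  shows "intertwines n (wedge z) (if fst z = a then 1 else - 1) (Q a) (wedge (shift a z))"
  using Q_wedge[OF assms, of "snd z"] by (cases z) (auto simp: shift_def)

lemma Q_contract_shift:
  assumes "a < n" "fst z < n"
  shows "intertwines n (contract z) (if fst z = a then 1 else - 1) (Q a) (contract (shift a z))"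
  using Q_contract[OF assms, of "snd z"] by (cases z) (auto simp: shift_def)

text \<open>The axioms fix \<open>Q a\<close> on the vacuum and its relations with fermions. Every
  monomial arises from the vacuum by wedgings and contractions, so the induction is on the number of
  particles and holes: a particle is removed or a hole is filled, and the missing fermion is then
  moved past \<open>Q a\<close>.\<close>

lemma Q_monomial:
  assumes a: "a < n" and S: "semi_infinite n S"
  shows "\<exists>c. (c = 1 \<or> c = - 1) \<and> Q a (monomial S) = scale c (monomial (shift a -` S))"
  using S
proof (induction "card (S - sea n) + card (sea n - S)" arbitrary: S rule: less_induct)
  case less
  have fin: "finite (S - sea n)" "finite (sea n - S)" using less.prems by (auto simp: semi_infinite_def)
  consider "S = sea n" | x where "x \<in> S - sea n" | x where "x \<in> sea n - S" by blast
  then show ?case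
  proof cases
    case 1
    have "shift a -` sea n = insert (a, - 1) (sea n)"
      using a by (auto simp: shift_def sea_def split: if_splits)
    moreover have "Q a (monomial (sea n)) = scale (reorder_sign (a, - 1) (sea n) * 1) (monomial (insert (a, - 1) (sea n)))"
      using Q_vac[OF a] wedge_monomial[of "(a, - 1)" "sea n" 1] by (simp add: vac_def sea_def)
    ultimately show ?thesis using 1 reorder_sign_cases by (metis mult.right_neutral)
  next
    case (2 x)
    let ?S = "S - {x}" and ?z = "unshift a x"
    have S: "semi_infinite n ?S" using less.prems by (rule semi_infinite_remove)
    have x: "fst x < n" using 2 less.prems by (auto simp: semi_infinite_def)
    have "?S - sea n = (S - sea n) - {x}" "sea n - ?S = sea n - S" using 2 by auto
    then have "card (?S - sea n) + card (sea n - ?S) < card (S - sea n) + card (sea n - S)"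
      using fin 2 by (simp add: card_Diff1_less del: card_Diff_insert)
    then obtain c where c: "c = 1 \<or> c = - 1" "Q a (monomial ?S) = scale c (monomial (shift a -` ?S))"
      using less.hyps S by blast
    let ?e = "if fst ?z = a then 1 else - 1 :: complex"
    let ?r = "reorder_sign x ?S" and ?r' = "reorder_sign ?z (shift a -` ?S)"
    have "wedge x (monomial ?S) = scale ?r (monomial S)"
      using wedge_monomial[of x ?S 1] 2 by (simp add: insert_absorb)
    then have "monomial S = scale ?r (wedge x (monomial ?S))" by simp
    then have "Q a (monomial S) = scale ?r (Q a (wedge x (monomial ?S)))"
      using a x S by (metis Q_scale Fock_wedge monomial_Fock)
    also have "Q a (wedge x (monomial ?S)) = scale ?e (wedge ?z (Q a (monomial ?S)))"
      using Q_wedge_shift[OF a, of ?z] x S by (auto simp: intertwines_def fst_unshift)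
    also have "wedge ?z (Q a (monomial ?S)) = scale (?r' * c) (monomial (insert ?z (shift a -` ?S)))"
      unfolding c(2) by (rule wedge_monomial) simp
    also have "insert ?z (shift a -` ?S) = shift a -` S"
      using 2 unfolding vimage_shift by auto
    finally have "Q a (monomial S) = scale (?r * (?e * (?r' * c))) (monomial (shift a -` S))" by simp
    moreover have "?r * (?e * (?r' * c)) = 1 \<or> ?r * (?e * (?r' * c)) = - 1"
      using c(1) reorder_sign_cases[of x ?S] reorder_sign_cases[of ?z "shift a -` ?S"] by auto
    ultimately show ?thesis by blast
  next
    case (3 x)
    let ?S = "insert x S" and ?z = "unshift a x"
    have x: "fst x < n" using 3 by (auto simp: sea_def)
    have S: "semi_infinite n ?S" using less.prems x by (rule semi_infinite_insert)
    have "sea n - ?S = (sea n - S) - {x}" "?S - sea n = S - sea n" using 3 by auto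
    then have "card (?S - sea n) + card (sea n - ?S) < card (S - sea n) + card (sea n - S)"
      using fin 3 by (simp add: card_Diff1_less del: card_Diff_insert)
    then obtain c where c: "c = 1 \<or> c = - 1" "Q a (monomial ?S) = scale c (monomial (shift a -` ?S))"
      using less.hyps S by blast
    let ?e = "if fst ?z = a then 1 else - 1 :: complex"
    let ?r = "reorder_sign x S" and ?r' = "reorder_sign ?z (shift a -` ?S - {?z})"
    have "contract x (monomial ?S) = scale ?r (monomial S)"
      using contract_monomial[of x ?S 1] 3 by simp
    then have "monomial S = scale ?r (contract x (monomial ?S))" by simp
    then have "Q a (monomial S) = scale ?r (Q a (contract x (monomial ?S)))"
      using a x S by (metis Q_scale Fock_contract monomial_Fock)
    also have "Q a (contract x (monomial ?S)) = scale ?e (contract ?z (Q a (monomial ?S)))"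
      using Q_contract_shift[OF a, of ?z] x S by (auto simp: intertwines_def fst_unshift)
    also have "contract ?z (Q a (monomial ?S)) = scale (?r' * c) (monomial (shift a -` ?S - {?z}))"
      unfolding c(2) by (rule contract_monomial) simp
    also have "shift a -` ?S - {?z} = shift a -` S"
      using 3 by auto (metis shift_unshift(2))
    finally have "Q a (monomial S) = scale (?r * (?e * (reorder_sign ?z (shift a -` S) * c))) (monomial (shift a -` S))" by simp
    moreover have "?r * (?e * (reorder_sign ?z (shift a -` S) * c)) = 1 \<or> ?r * (?e * (reorder_sign ?z (shift a -` S) * c)) = - 1"
      using c(1) reorder_sign_cases[of x S] reorder_sign_cases[of ?z "shift a -` S"] by auto
    ultimately show ?thesis by blast
  qed
qed

text \<open>Distinct monomials have distinct images under \<open>Q a\<close>, so only one term of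
  the finite expansion of \<open>v\<close> contributes. In terms of coefficients this is the
  isometry property.\<close>

lemma Q_apply_shift:
  assumes a: "a < n" and S: "semi_infinite n S" and v: "v \<in> Fock n"
    and c: "Q a (monomial S) = scale c (monomial (shift a -` S))"
  shows "Q a v (shift a -` S) = c * v S"
proof -
  let ?A = "{R. v R \<noteq> 0}"
  have A: "finite ?A" "\<And>R. R \<in> ?A \<Longrightarrow> semi_infinite n R" using v by (auto simp: Fock_def)
  have inj: "shift a -` R = shift a -` S \<longleftrightarrow> R = S" for R
    by (metis vimage_shift inj_image_eq_iff inj_on_inverseI shift_unshift(1))
  have "Q a v = (\<Sum>R\<in>?A. scale (v R) (Q a (monomial R)))"
  proof -
    have "Q a v = Q a (\<Sum>R\<in>?A. scale (v R) (monomial R))" using Fock_expansion[OF v] by simp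
    also have "\<dots> = (\<Sum>R\<in>?A. Q a (scale (v R) (monomial R)))"
      using A by (intro Q_sum[OF a]) (auto intro: Fock_scale)
    also have "\<dots> = (\<Sum>R\<in>?A. scale (v R) (Q a (monomial R)))"
      using A by (intro sum.cong refl Q_scale[OF a]) auto
    finally show ?thesis .
  qed
  then have "Q a v (shift a -` S) = (\<Sum>R\<in>?A. v R * Q a (monomial R) (shift a -` S))"
    by (simp add: sum_fock_apply) (simp add: scale_def)
  also have "\<dots> = (\<Sum>R\<in>?A. if R = S then c * v S else 0)"
  proof (intro sum.cong refl)
    fix R assume "R \<in> ?A"
    then obtain d where "Q a (monomial R) = scale d (monomial (shift a -` R))"
      using Q_monomial[OF a] A(2) by blast
    then show "v R * Q a (monomial R) (shift a -` S) = (if R = S then c * v S else 0)"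
      using c inj[of R] by (cases "R = S") (auto simp: scale_def monomial_def)
  qed
  also have "\<dots> = c * v S" using A(1) by simp
  finally show ?thesis .
qed

lemma semi_infinite_shift:
  assumes "a < n" "semi_infinite n S"
  shows "semi_infinite n (shift a ` S)"
proof -
  have 1: "shift a ` S - sea n \<subseteq> shift a ` (S - sea n)"
  proof -
    have "shift a z \<in> sea n" if "z \<in> sea n" for z
      using that by (auto simp: shift_def sea_def)
    then show ?thesis by blast
  qed
  \<comment> \<open>Raising the modes of colour \<open>a\<close> opens at most one new hole:
    \<open>(a, 0)\<close> is the only site of the sea that \<open>unshift a\<close> takes out of the
    sea.\<close>
  have 2: "sea n - shift a ` S \<subseteq> insert (a, 0) (shift a ` (sea n - S))"
  proof
    fix z assume z: "z \<in> sea n - shift a ` S"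
    then have "unshift a z \<notin> S" by (metis DiffD2 image_eqI shift_unshift(1))
    moreover have "unshift a z \<in> sea n \<or> z = (a, 0)"
      using z by (cases z) (auto simp: unshift_def sea_def)
    ultimately show "z \<in> insert (a, 0) (shift a ` (sea n - S))"
      by (metis DiffI image_eqI insertCI shift_unshift(1))
  qed
  have "shift a ` S \<subseteq> {0..<n} \<times> UNIV"
    using assms(2) by (auto simp: semi_infinite_def shift_def)
  then show ?thesis
    using 1 2 assms(2) unfolding semi_infinite_def
    by (meson finite_imageI finite_insert finite_subset)
qed

lemma fock_auto_Q:
  assumes a: "a < n"
  shows "fock_auto n (Q a)"
  unfolding fock_auto_def
proof (intro conjI allI ballI impI Q_bij[OF a])
  fix c u v
  show "Q a (scale c v) = scale c (Q a v)" if "v \<in> Fock n" using that by (rule Q_scale[OF a])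
  have monom: "\<exists>d. (d = 1 \<or> d = - 1) \<and> Q a (scale c (monomial S)) = scale d (monomial (shift a -` S))"
    if S: "semi_infinite n S" "c = 1 \<or> c = - 1" for S c
  proof -
    obtain d where "d = 1 \<or> d = - 1" "Q a (monomial S) = scale d (monomial (shift a -` S))"
      using Q_monomial[OF a S(1)] by blast
    then have "Q a (scale c (monomial S)) = scale (c * d) (monomial (shift a -` S))" "c * d = 1 \<or> c * d = - 1"
      using S by (auto simp: Q_scale[OF a])
    then show ?thesis by blast
  qed
  show "signed_monomial n (Q a u)" if u: "signed_monomial n u"
  proof -
    obtain S c where S: "semi_infinite n S" "c = 1 \<or> c = - 1" "u = scale c (monomial S)"
      using u by (auto simp: signed_monomial_def)
    obtain d where d: "d = 1 \<or> d = - 1" "Q a u = scale d (monomial (shift a -` S))"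
      using monom[OF S(1,2)] S(3) by blast
    \<comment> \<open>Semi-infiniteness of the shifted set is read off from the fact that
      \<open>Q a\<close> preserves Fock space.\<close>
    have "Q a u \<in> Fock n" using a signed_monomial_Fock[OF u] by (rule Q_closed)
    then have "scale d (Q a u) \<in> Fock n" by (rule Fock_scale)
    then have "monomial (shift a -` S) \<in> Fock n" using d by auto
    then show ?thesis using d unfolding signed_monomial_def by auto
  qed
  show "signed_monomial n (inv_into (Fock n) (Q a) u)" if u: "signed_monomial n u"
  proof -
    obtain S c where S: "semi_infinite n S" "c = 1 \<or> c = - 1" "u = scale c (monomial S)"
      using u by (auto simp: signed_monomial_def)
    have T: "semi_infinite n (shift a ` S)" using a S(1) by (rule semi_infinite_shift)
    have "shift a -` shift a ` S = S" by (simp add: vimage_shift image_image)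
    then obtain d where d: "d = 1 \<or> d = - 1" "Q a (scale c (monomial (shift a ` S))) = scale d (monomial S)"
      using monom[OF T S(2)] by auto
    \<comment> \<open>Since \<open>c\<close> and \<open>d\<close> square to one, the factor
      \<open>c * d\<close> turns the right side into \<open>u\<close> and leaves the coefficient
      \<open>d\<close> in the argument, which exhibits the preimage of \<open>u\<close>.\<close>
    have "Q a (scale (c * d) (scale c (monomial (shift a ` S)))) = scale (c * d) (scale d (monomial S))"
      using d(2) T by (subst Q_scale[OF a]) (auto intro: Fock_scale)
    then have "Q a (scale d (monomial (shift a ` S))) = u"
      using d(1) S(2,3) by auto
    then have "inv_into (Fock n) (Q a) u = scale d (monomial (shift a ` S))"
      using Q_bij[OF a] T by (intro inv_into_f_eq) (auto simp: bij_betw_def intro: Fock_scale)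
    then show ?thesis using T d(1) by (auto simp: signed_monomial_def)
  qed
  show "inner (Q a u) (Q a v) = inner u v" if u: "signed_monomial n u" and v: "v \<in> Fock n"
  proof -
    obtain S c where S: "semi_infinite n S" "u = scale c (monomial S)"
      using u by (auto simp: signed_monomial_def)
    obtain d where d: "d = 1 \<or> d = - 1" "Q a (monomial S) = scale d (monomial (shift a -` S))"
      using Q_monomial[OF a S(1)] by blast
    then have "Q a u = scale (c * d) (monomial (shift a -` S))"
      using S by (simp add: Q_scale[OF a])
    then show ?thesis
      using Q_apply_shift[OF a S(1) v d(2)] d(1) S(2) by (auto simp: inner_scale_monomial)
  qed
qed

text \<open>The families covered by this notion are the wedgings, the contractions and \<open>Q c\<close> itself.\<close>

definition graded_family :: "nat \<Rightarrow> (int \<Rightarrow> fock \<Rightarrow> fock) \<Rightarrow> bool" where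
  "graded_family c A \<longleftrightarrow> c < n \<and> (\<forall>k. \<forall>v\<in>Fock n. A k v \<in> Fock n) \<and>
     (\<forall>k. intertwines n (A k) 1 (Q c) (A (k + 1))) \<and>
     (\<forall>k. \<forall>a<n. a \<noteq> c \<longrightarrow> intertwines n (A k) (- 1) (Q a) (A k))"

lemma graded_family_wedge: "c < n \<Longrightarrow> graded_family c (\<lambda>k. wedge (c, k))"
  by (auto simp: graded_family_def Q_wedge Fock_wedge)

lemma graded_family_contract: "c < n \<Longrightarrow> graded_family c (\<lambda>k. contract (c, k))"
  by (auto simp: graded_family_def Q_contract Fock_contract)

text \<open>\<open>Q c\<close> obeys the sign rule of fermions of colour \<open>c\<close> and has no
  mode to shift. Treating it as a constant family lets reorderings of products of translation
  operators use the same computation.\<close>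

lemma graded_family_Q: "c < n \<Longrightarrow> graded_family c (\<lambda>k. Q c)"
  by (auto simp: graded_family_def Q_anticommute Q_closed) (simp add: intertwines_def)

section \<open>Products of powers of translation operators\<close>

abbreviation Q_inv :: "nat \<Rightarrow> fock \<Rightarrow> fock" where
  "Q_inv a \<equiv> inv_into (Fock n) (Q a)"

lemma fock_auto_Q_int_power: "a < n \<Longrightarrow> fock_auto n (Q_int_power n Q a z)"
  by (auto simp: Q_int_power_def intro: fock_auto_power fock_auto_Q fock_auto_inv)

lemma Q_Q_int_power:
  assumes "a < n" "v \<in> Fock n"
  shows "Q a (Q_int_power n Q a z v) = Q_int_power n Q a (z + 1) v"
proof (cases "z \<ge> 0")
  case True
  then have "nat (z + 1) = Suc (nat z)" by simp
  then show ?thesis using True by (simp add: Q_int_power_def)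
next
  case False
  then have *: "nat (- z) = Suc (nat (- (z + 1)))" by simp
  have "Q a (Q_int_power n Q a z v) = (Q_inv a ^^ nat (- (z + 1))) v"
    using False assms fock_auto_closed[OF fock_auto_power[OF fock_auto_inv[OF fock_auto_Q[OF assms(1)]]] assms(2)]
    by (simp add: Q_int_power_def * fock_auto_inv_right[OF fock_auto_Q])
  also have "\<dots> = Q_int_power n Q a (z + 1) v"
    using False by (auto simp: Q_int_power_def)
  finally show ?thesis .
qed

text \<open>A factor of the colour of the family shifts the mode without sign, and a factor of any
  other colour changes the sign without shifting the mode.\<close>

lemma intertwines_Q_power:
  assumes A: "graded_family c A" and a: "a < n"
  shows "intertwines n (A k) (if a = c then 1 else parity_sign m) (Q a ^^ m)
           (A (if a = c then k + m else k))"
proof (induction m arbitrary: k)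
  case 0
  then show ?case using intertwines_id[unfolded id_def] by (simp add: id_def)
next
  case (Suc m)
  have Q: "intertwines n (A k) (if a = c then 1 else - 1) (Q a) (A (if a = c then k + 1 else k))" for k
    using A a by (auto simp: graded_family_def)
  have "intertwines n (A k) ((if a = c then 1 else - 1) * (if a = c then 1 else parity_sign m)) (Q a \<circ> Q a ^^ m)
     (A (if a = c then (if a = c then k + 1 else k) + m else (if a = c then k + 1 else k)))"
    by (rule intertwines_comp[OF Q Suc fock_auto_Q fock_auto_power[OF fock_auto_Q]])
      (use A a in \<open>auto simp: graded_family_def\<close>)
  moreover have "parity_sign (int (Suc m)) = - 1 * parity_sign (int m)" "k + 1 + int m = k + int (Suc m)" "k - 1 - int m = k - int (Suc m)"
    by (simp_all add: parity_sign_def)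
  ultimately show ?case
    unfolding funpow.simps by (cases "a = c") (simp_all only: if_True if_False mult_1, simp del: o_apply)
qed

lemma intertwines_Q_inv_power:
  assumes A: "graded_family c A" and a: "a < n"
  shows "intertwines n (A k) (if a = c then 1 else parity_sign m) (Q_inv a ^^ m)
           (A (if a = c then k - m else k))"
proof (induction m arbitrary: k)
  case 0
  then show ?case using intertwines_id[unfolded id_def] by (simp add: id_def)
next
  case (Suc m)
  have Q: "intertwines n (A k) (if a = c then 1 else - 1) (Q_inv a) (A (if a = c then k - 1 else k))" for k
  proof (cases "a = c")
    case True
    have "intertwines n (A (k - 1)) 1 (Q c) (A (k - 1 + 1))"
      using A unfolding graded_family_def by blast
    then show ?thesis
      using True intertwines_inv[of n "A (k - 1)" 1 "Q c" "A k"] fock_auto_Q[OF a] A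
      by (auto simp: graded_family_def)
  next
    case False
    then show ?thesis
      using intertwines_inv[of n "A k" "- 1" "Q a" "A k"] fock_auto_Q[OF a] A a
      by (auto simp: graded_family_def)
  qed
  have "intertwines n (A k) ((if a = c then 1 else - 1) * (if a = c then 1 else parity_sign m)) (Q_inv a \<circ> Q_inv a ^^ m)
     (A (if a = c then (if a = c then k - 1 else k) - m else (if a = c then k - 1 else k)))"
    by (rule intertwines_comp[OF Q Suc fock_auto_inv[OF fock_auto_Q] fock_auto_power[OF fock_auto_inv[OF fock_auto_Q]]])
      (use A a in \<open>auto simp: graded_family_def\<close>)
  moreover have "parity_sign (int (Suc m)) = - 1 * parity_sign (int m)" "k + 1 + int m = k + int (Suc m)" "k - 1 - int m = k - int (Suc m)"
    by (simp_all add: parity_sign_def)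
  ultimately show ?case
    unfolding funpow.simps by (cases "a = c") (simp_all only: if_True if_False mult_1, simp del: o_apply)
qed

lemma intertwines_Q_int_power:
  assumes "graded_family c A" "a < n"
  shows "intertwines n (A k) (if a = c then 1 else parity_sign z) (Q_int_power n Q a z)
           (A (if a = c then k + z else k))"
  using intertwines_Q_power[OF assms, of k "nat z"] intertwines_Q_inv_power[OF assms, of k "nat (- z)"]
  by (auto simp: Q_int_power_def split: if_splits)

text \<open>\<open>Q_power\<close> for an arbitrary list of colours in place of
  \<open>[0..<n]\<close>, to permit induction over the list.\<close>

definition Q_list :: "nat list \<Rightarrow> (nat \<Rightarrow> int) \<Rightarrow> fock \<Rightarrow> fock" where
  "Q_list xs B = foldr (\<lambda>a f. Q_int_power n Q a (B a) \<circ> f) xs id"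

lemma Q_list_simps [simp]:
  "Q_list [] B = id" "Q_list (a # xs) B = Q_int_power n Q a (B a) \<circ> Q_list xs B"
  by (simp_all add: Q_list_def)

lemma fock_auto_Q_list: "set xs \<subseteq> {0..<n} \<Longrightarrow> fock_auto n (Q_list xs B)"
  by (induction xs) (auto intro: fock_auto_comp fock_auto_Q_int_power fock_auto_id)

lemma intertwines_Q_list:
  assumes A: "graded_family c A" and "set xs \<subseteq> {0..<n}" "distinct xs"
  shows "intertwines n (A k) (parity_sign (sum B (set xs - {c}))) (Q_list xs B)
           (A (if c \<in> set xs then k + B c else k))"
  using assms(2,3)
proof (induction xs arbitrary: k)
  case Nil
  then show ?case using intertwines_id[unfolded id_def] by (simp add: id_def)
next
  case (Cons a xs)
  let ?k = "if a = c then k + B a else k"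
  have "intertwines n (A k) ((if a = c then 1 else parity_sign (B a)) * parity_sign (sum B (set xs - {c})))
     (Q_int_power n Q a (B a) \<circ> Q_list xs B) (A (if c \<in> set xs then ?k + B c else ?k))"
  proof (rule intertwines_comp)
    show "intertwines n (A k) (if a = c then 1 else parity_sign (B a)) (Q_int_power n Q a (B a)) (A ?k)"
      using Cons.prems by (intro intertwines_Q_int_power A) auto
    show "intertwines n (A ?k) (parity_sign (sum B (set xs - {c}))) (Q_list xs B) (A (if c \<in> set xs then ?k + B c else ?k))"
      using Cons by auto
  qed (use Cons.prems A in \<open>auto simp: graded_family_def intro: fock_auto_Q_int_power fock_auto_Q_list\<close>)
  moreover have "(if a = c then 1 else parity_sign (B a)) * parity_sign (sum B (set xs - {c})) =
      parity_sign (sum B (set (a # xs) - {c}))"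
    using Cons.prems(2) by (auto simp: insert_Diff_if parity_sign_add)
  ultimately show ?case using Cons.prems(2) unfolding Q_list_simps
    by (auto split: if_splits simp del: o_apply)
qed

lemma Q_list_cong: "(\<And>i. i \<in> set xs \<Longrightarrow> B i = C i) \<Longrightarrow> Q_list xs B = Q_list xs C"
  by (induction xs) auto

text \<open>\<open>Q c\<close> is carried from the front to its own power and passes just the
  factors standing before it. As the list is increasing, these are the factors of smaller
  index.\<close>

lemma Q_Q_list:
  assumes "c < n" "v \<in> Fock n" "set xs \<subseteq> {0..<n}" "sorted_wrt (<) xs" "c \<in> set xs"
  shows "Q c (Q_list xs B v) = scale (parity_sign (sum B {i \<in> set xs. i < c})) (Q_list xs (B + delta c) v)"
  using assms(3-)
proof (induction xs)
  case (Cons a xs)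
  have w: "Q_list xs B v \<in> Fock n" for B
    using Cons.prems assms(2) by (auto intro: fock_auto_closed[OF fock_auto_Q_list])
  show ?case
  proof (cases "c = a")
    case True
    have eq: "Q_list xs (B + delta c) = Q_list xs B"
      using Cons.prems True by (intro Q_list_cong) (auto simp: delta_def)
    moreover have none: "{i. (i = a \<or> i \<in> set xs) \<and> i < a} = {}" using Cons.prems by auto
    ultimately show ?thesis
      using True w[of B] assms(1)
      unfolding Q_list_simps comp_apply eq by (simp add: Q_Q_int_power none delta_def)
  next
    case False
    then have c: "c \<in> set xs" "a < c" "a < n" "c \<noteq> a" using Cons.prems by auto
    have "{i \<in> set (a # xs). i < c} = insert a {i \<in> set xs. i < c}" "a \<notin> {i \<in> set xs. i < c}"
      using c Cons.prems by auto
    then have sgn: "parity_sign (sum B {i \<in> set (a # xs). i < c}) = parity_sign (B a) * parity_sign (sum B {i \<in> set xs. i < c})"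
      by (simp add: parity_sign_add)
    have "Q c (Q_list (a # xs) B v) = scale (parity_sign (B a)) (Q_int_power n Q a (B a) (Q c (Q_list xs B v)))"
      using intertwines_Q_int_power[OF graded_family_Q[OF assms(1)] c(3), of "B a"] w c(4)
      by (auto simp: intertwines_def)
    also have "Q c (Q_list xs B v) = scale (parity_sign (sum B {i \<in> set xs. i < c})) (Q_list xs (B + delta c) v)"
      using Cons.IH Cons.prems c(1) by (simp del: plus_fun_apply)
    finally have "Q c (Q_list (a # xs) B v) = scale (parity_sign (B a)) (Q_int_power n Q a (B a)
        (scale (parity_sign (sum B {i \<in> set xs. i < c})) (Q_list xs (B + delta c) v)))" .
    moreover have "(B + delta c) a = B a" using c(2) by (simp add: delta_def)
    ultimately show ?thesis
      unfolding sgn Q_list_simps comp_apply fock_auto_scale[OF fock_auto_Q_int_power[OF c(3)] w] scale_scale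
      by (simp only:)
  qed
qed simp

abbreviation QP :: "(nat \<Rightarrow> int) \<Rightarrow> fock \<Rightarrow> fock" where
  "QP \<equiv> Q_power n Q"

abbreviation QP_inv :: "(nat \<Rightarrow> int) \<Rightarrow> fock \<Rightarrow> fock" where
  "QP_inv B \<equiv> inv_into (Fock n) (QP B)"

text \<open>\<open>lower_sign\<close> is the cost of absorbing \<open>Q c\<close> into
  \<open>Q^B\<close> from the left; \<open>other_sign\<close> is the cost of moving an operator of
  colour \<open>c\<close> through all of \<open>Q^B\<close>. Absorption from the right costs the
  product of the two.\<close>

definition lower_sign :: "nat \<Rightarrow> (nat \<Rightarrow> int) \<Rightarrow> complex" where
  "lower_sign c B = parity_sign (sum B {0..<c})"

definition other_sign :: "nat \<Rightarrow> (nat \<Rightarrow> int) \<Rightarrow> complex" where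
  "other_sign c B = parity_sign (sum B ({0..<n} - {c}))"

lemma Q_power_eq_Q_list: "QP B = Q_list [0..<n] B"
  by (simp add: Q_power_def Q_list_def)

lemma fock_auto_QP: "fock_auto n (QP B)"
  unfolding Q_power_eq_Q_list by (rule fock_auto_Q_list) simp

lemma QP_graded:
  assumes "graded_family c A" "v \<in> Fock n"
  shows "A k (QP B v) = scale (other_sign c B) (QP B (A (k + B c) v))"
proof -
  have "c < n" using assms(1) by (simp add: graded_family_def)
  then show ?thesis
    using intertwines_Q_list[OF assms(1), of "[0..<n]" k B] assms(2)
    by (simp add: intertwines_def other_sign_def Q_power_eq_Q_list)
qed

lemma QP_inv_graded:
  assumes "graded_family c A" "v \<in> Fock n"
  shows "A k (QP_inv B v) = scale (other_sign c B) (QP_inv B (A (k - B c) v))"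
proof -
  have "intertwines n (A (k - B c)) (other_sign c B) (QP B) (A k)"
    using QP_graded[OF assms(1), of _ "k - B c"] by (simp add: intertwines_def)
  then have "intertwines n (A k) (other_sign c B) (QP_inv B) (A (k - B c))"
    by (rule intertwines_inv) (use assms(1) fock_auto_QP in \<open>auto simp: graded_family_def other_sign_def\<close>)
  then show ?thesis using assms(2) by (simp add: intertwines_def)
qed

lemma Q_QP:
  assumes "c < n" "v \<in> Fock n"
  shows "Q c (QP B v) = scale (lower_sign c B) (QP (B + delta c) v)"
proof -
  have "{i. i < n \<and> i < c} = {0..<c}" using assms(1) by auto
  then show ?thesis using Q_Q_list[OF assms, of "[0..<n]" B] assms(1)
    by (simp add: lower_sign_def Q_power_eq_Q_list)
qed

lemma QP_Q:
  assumes "c < n" "v \<in> Fock n"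
  shows "QP B (Q c v) = scale (other_sign c B * lower_sign c B) (QP (B + delta c) v)"
proof -
  have "scale (lower_sign c B) (QP (B + delta c) v) = scale (other_sign c B) (QP B (Q c v))"
    using Q_QP[OF assms, of B] QP_graded[OF graded_family_Q[OF assms(1)] assms(2), of B] by simp
  then have "scale (other_sign c B) (scale (lower_sign c B) (QP (B + delta c) v)) =
      scale (other_sign c B) (scale (other_sign c B) (QP B (Q c v)))" by simp
  then show ?thesis by (simp add: other_sign_def)
qed

end

section \<open>The bilinear identity\<close>

lemma Fock_Gamma:
  assumes "\<And>m. f m \<in> Fock n" "a < n"
  shows "Gamma a b f m \<in> Fock n"
  unfolding Gamma_def by (intro Fock_sum) (auto simp: psi_def intro!: Fock_wedge Fock_contract assms)

lemma Fock_exp_Gamma: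
  assumes "\<And>m. f m \<in> Fock n" "a < n"
  shows "exp_Gamma a b f m \<in> Fock n"
proof -
  have "(Gamma a b ^^ N) f m \<in> Fock n" for N m
    by (induction N arbitrary: m) (auto intro: Fock_Gamma assms)
  then show ?thesis unfolding exp_Gamma_def by (intro Fock_sum Fock_scale)
qed

lemma Fock_group_element:
  assumes "v \<in> Fock n"
  shows "group_element n v m \<in> Fock n"
proof -
  have "foldr (\<lambda>(a, b). exp_Gamma a b) ps (const_series v) m \<in> Fock n"
    if "\<forall>(a, b)\<in>set ps. a < n" for ps
    using that by (induction ps arbitrary: m)
      (auto simp: const_series_def assms Fock_zero intro: Fock_exp_Gamma)
  moreover have "\<forall>(a, b)\<in>set (ordered_pairs n). a < n"
    by (auto simp: ordered_pairs_def)
  ultimately show ?thesis unfolding group_element_def by blast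
qed

lemma Omega_tensor:
  "Omega (\<lambda>S T. v S * w T) S T = (\<Sum>z\<in>S - T. wedge z v S * contract z w T)"
  by (simp add: Omega_def wedge_linear contract_linear)

text \<open>The bras single out one coefficient pair \<open>(S, T)\<close> of the commutation of
  \<open>Omega\<close> with the group element, and adjointness moves \<open>Omega\<close> onto them.
  The set \<open>Z\<close> is left open so that it can be adapted to the bras: it has to be finite
  and contain every site that contributes.\<close>

lemma group_element_bilinear:
  assumes u: "signed_monomial n u" and u': "signed_monomial n u'"
    and vw: "\<And>S T. semi_infinite n S \<Longrightarrow> semi_infinite n T \<Longrightarrow>
     Omega (\<lambda>S T. v S * w T) S T = (\<Sum>i\<in>A. c i * (v' i S * w' i T))"
    and Z: "finite Z" "\<And>z. fst z < n \<Longrightarrow> z \<notin> Z \<Longrightarrow> contract z u = 0 \<or> wedge z u' = 0"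
  shows "(\<Sum>z\<in>Z. \<Sum>(p, q) | p + q = m.
      inner (contract z u) (group_element n v p) * inner (wedge z u') (group_element n w q)) =
    (\<Sum>i\<in>A. c i * (\<Sum>(p, q) | p + q = m.
      inner u (group_element n (v' i) p) * inner u' (group_element n (w' i) q)))"
proof -
  let ?G = "group_element n"
  obtain S s where S: "semi_infinite n S" "u = scale s (monomial S)" using u by (auto simp: signed_monomial_def)
  obtain T t where T: "semi_infinite n T" "u' = scale t (monomial T)" using u' by (auto simp: signed_monomial_def)
  have ST: "finite (S - T)" using S(1) T(1) by (rule finite_semi_infinite_diff)
  let ?h = "\<lambda>z. \<Sum>(p, q) | p + q = m. inner (contract z u) (?G v p) * inner (wedge z u') (?G w q)"
  have nz: "?h z = 0" if "contract z u = 0 \<or> wedge z u' = 0" for z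
    using that by auto
  \<comment> \<open>Outside \<open>Z\<close> the terms vanish by assumption, outside
    \<open>S - T\<close> because \<open>u\<close> lacks the site or \<open>u'\<close> already has
    it. Both sums therefore equal the sum over the union.\<close>
  have "(\<Sum>z\<in>Z. ?h z) = (\<Sum>z\<in>(S - T) \<union> Z. ?h z)"
  proof (rule sum.mono_neutral_left)
    show "\<forall>z\<in>S - T \<union> Z - Z. ?h z = 0"
    proof
      fix z assume z: "z \<in> S - T \<union> Z - Z"
      then have "fst z < n" using S(1) by (auto simp: semi_infinite_def)
      then show "?h z = 0" using z Z(2) by (intro nz) blast
    qed
  qed (use ST Z in auto)
  also have "\<dots> = (\<Sum>z\<in>S - T. ?h z)"
  proof (rule sum.mono_neutral_right)
    show "\<forall>z\<in>S - T \<union> Z - (S - T). ?h z = 0"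
    proof
      fix z assume "z \<in> S - T \<union> Z - (S - T)"
      then have "contract z u = 0 \<or> wedge z u' = 0"
        using S(2) T(2) by (auto simp: contract_def wedge_def scale_def monomial_def fun_eq_iff)
      then show "?h z = 0" by (rule nz)
    qed
  qed (use ST Z in auto)
  also have "\<dots> = (\<Sum>z\<in>S - T. \<Sum>(p, q) | p + q = m. s * t * (wedge z (?G v p) S * contract z (?G w q) T))"
    unfolding inner_wedge[OF u, symmetric] inner_contract[OF u', symmetric]
    by (simp add: S(2) T(2) inner_scale_monomial mult_ac)
  also have "\<dots> = s * t * Omega (tensor_mult (?G v) (?G w) m) S T"
  proof -
    have "wedge z (\<lambda>S'. contract z (tensor_mult f g m S') T) S =
        (\<Sum>(p, q) | p + q = m. wedge z (f p) S * contract z (g q) T)" for z f g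
      unfolding tensor_mult_def[abs_def] by (simp add: case_prod_unfold wedge_linear contract_linear)
    then show ?thesis by (simp add: Omega_def sum_distrib_left case_prod_unfold)
  qed
  also have "Omega (tensor_mult (?G v) (?G w) m) S T = (\<Sum>i\<in>A. c i * tensor_mult (?G (v' i)) (?G (w' i)) m S T)"
    using Omega_group_element[OF vw] S(1) T(1) unfolding agree_def by blast
  also have "s * t * \<dots> = (\<Sum>i\<in>A. c i * (\<Sum>(p, q) | p + q = m. inner u (?G (v' i) p) * inner u' (?G (w' i) q)))"
    by (simp add: S(2) T(2) inner_scale_monomial tensor_mult_def case_prod_unfold sum_distrib_left mult_ac)
  finally show ?thesis .
qed

lemma wedge_vac:
  assumes "c < n" "0 \<le> k"
  shows "wedge (c, k) (vac n) = 0"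
proof -
  have "(c, k) \<in> sea n" using assms by (simp add: sea_def)
  then have "T - {(c, k)} \<noteq> sea n" for T by blast
  then show ?thesis by (simp add: wedge_def vac_def monomial_def fun_eq_iff)
qed

lemma contract_vac:
  assumes "k < 0"
  shows "contract (c, k) (vac n) = 0"
proof -
  have "(c, k) \<notin> sea n" using assms by (simp add: sea_def)
  then have "insert (c, k) T \<noteq> sea n" for T by blast
  then show ?thesis by (simp add: contract_def vac_def monomial_def fun_eq_iff)
qed

section \<open>Bras, kets and the action of fermions on them\<close>

context translation_system
begin

lemma sum_delta:
  "finite X \<Longrightarrow> c \<notin> X \<Longrightarrow> sum (B + delta c) X = sum B X"
  "finite X \<Longrightarrow> c \<notin> X \<Longrightarrow> sum (B - delta c) X = sum B X"
  by (auto simp: delta_def intro!: sum.cong)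

text \<open>Neither sign involves the entry at \<open>c\<close> itself, and parities ignore
  negation. Hence shifts by \<open>delta c\<close> never disturb the signs attached to colour
  \<open>c\<close>.\<close>

lemma sign_simps [simp]:
  "lower_sign c (B + delta c) = lower_sign c B" "lower_sign c (B - delta c) = lower_sign c B"
  "lower_sign c (- B) = lower_sign c B" "lower_sign c B * lower_sign c B = 1"
  "other_sign c (B + delta c) = other_sign c B" "other_sign c (B - delta c) = other_sign c B"
  "other_sign c (- B) = other_sign c B" "other_sign c B * other_sign c B = 1"
  by (simp_all add: lower_sign_def other_sign_def sum_delta sum_negf del: plus_fun_apply minus_apply)

lemma fock_auto_QP_inv: "fock_auto n (QP_inv B)"
  by (intro fock_auto_inv fock_auto_QP)

lemmas QP_closed = fock_auto_closed[OF fock_auto_QP]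
lemmas QP_inv_closed = fock_auto_closed[OF fock_auto_QP_inv]

lemma QP_inv_Q:
  assumes "c < n" "v \<in> Fock n"
  shows "QP_inv B (Q c v) = scale (lower_sign c B) (QP_inv (B - delta c) v)"
proof (rule fock_auto_inv_eq[OF fock_auto_QP])
  let ?x = "QP_inv (B - delta c) v"
  have x: "?x \<in> Fock n" using assms(2) by (rule QP_inv_closed)
  have B: "B - delta c + delta c = B" by (rule ext) simp
  have "Q c v = Q c (QP (B - delta c) ?x)"
    using fock_auto_inv_right[OF fock_auto_QP assms(2)] by simp
  also have "\<dots> = scale (lower_sign c B) (QP B ?x)"
    unfolding Q_QP[OF assms(1) x] B by simp
  finally show "QP B (scale (lower_sign c B) ?x) = Q c v"
    by (simp add: fock_auto_scale[OF fock_auto_QP x])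
  show "scale (lower_sign c B) ?x \<in> Fock n" using x by (rule Fock_scale)
qed

lemma Q_inv_vac':
  assumes "c < n"
  shows "contract (c, 0) (vac n) \<in> Fock n" "Q c (contract (c, 0) (vac n)) = vac n"
  using Q_inv_vac[OF assms] fock_auto_inv_right[OF fock_auto_Q[OF assms] vac_Fock]
  by (simp_all add: Fock_contract vac_Fock)

definition bra :: "(nat \<Rightarrow> int) \<Rightarrow> (nat \<Rightarrow> int) \<Rightarrow> fock" where
  "bra \<kappa> B = QP_inv B (QP (- \<kappa>) (vac n))"

definition ket :: "(nat \<Rightarrow> int) \<Rightarrow> fock" where
  "ket B = QP_inv B (vac n)"

lemma signed_monomial_bra: "signed_monomial n (bra \<kappa> B)"
  unfolding bra_def
  by (intro fock_auto_signed_monomial[OF fock_auto_QP_inv] fock_auto_signed_monomial[OF fock_auto_QP] signed_monomial_vac)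

lemma ket_Fock: "ket B \<in> Fock n"
  unfolding ket_def by (rule QP_inv_closed[OF vac_Fock])

text \<open>Isometry of \<open>Q^B\<close> moves the conjugation onto the vectors. After this, all
  \<open>\<tau>\<close>-functions are matrix coefficients of one group element, and only the bra and
  the ket depend on \<open>B\<close>.\<close>

lemma tau_eq: "tau n Q \<kappa> B m = inner (bra \<kappa> B) (group_element n (ket B) m)"
proof -
  have "QP (- \<kappa>) (vac n) = QP B (bra \<kappa> B)"
    unfolding bra_def by (rule fock_auto_inv_right[OF fock_auto_QP QP_closed[OF vac_Fock], symmetric])
  then show ?thesis
    unfolding tau_def T_power_def group_element_conj_def ket_def[symmetric]
    using fock_auto_inner[OF fock_auto_QP signed_monomial_bra Fock_group_element[OF ket_Fock]] by simp
qed

text \<open>Splitting off one \<open>Q c\<close> from \<open>T^\<kappa>\<close> and absorbing it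
  into the inverse of \<open>Q^B\<close> shows that a bra depends, up to sign, only on the sum of
  \<open>\<kappa>\<close> and \<open>B\<close>. This is what allows a bra to follow a change of the
  exponent of its ket.\<close>

lemma bra_shift:
  assumes "c < n"
  shows "bra \<kappa> B = scale (lower_sign c \<kappa> * lower_sign c B) (bra (\<kappa> + delta c) (B - delta c))"
proof -
  let ?w = "QP (- (\<kappa> + delta c)) (vac n)"
  have w: "?w \<in> Fock n" by (rule QP_closed[OF vac_Fock])
  have eq: "- (\<kappa> + delta c) + delta c = - \<kappa>" by (rule ext) simp
  have "Q c ?w = scale (lower_sign c \<kappa>) (QP (- \<kappa>) (vac n))"
    using Q_QP[OF assms vac_Fock, of "- (\<kappa> + delta c)"] unfolding eq sign_simps .
  then have "QP (- \<kappa>) (vac n) = scale (lower_sign c \<kappa>) (Q c ?w)" by simp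
  then have "bra \<kappa> B = QP_inv B (scale (lower_sign c \<kappa>) (Q c ?w))"
    unfolding bra_def by (rule arg_cong)
  then show ?thesis
    unfolding fock_auto_scale[OF fock_auto_QP_inv Q_closed[OF assms w]] QP_inv_Q[OF assms w] scale_scale bra_def .
qed

lemma bra_shift':
  assumes "c < n"
  shows "bra \<kappa> B = scale (lower_sign c \<kappa> * lower_sign c B) (bra (\<kappa> - delta c) (B + delta c))"
proof -
  have eq: "\<kappa> - delta c + delta c = \<kappa>" "B + delta c - delta c = B" by (rule ext, simp)+
  show ?thesis
    using bra_shift[OF assms, of "\<kappa> - delta c" "B + delta c"] unfolding eq sign_simps
    by (simp add: mult_ac)
qed

text \<open>Up to sign, \<open>ket B\<close> is the monomial whose colour \<open>c\<close> is filled
  exactly from mode \<open>B c\<close> upwards. Filling the site just below that level is the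
  translation by \<open>Q c\<close> and gives a ket again.\<close>

lemma ket_wedge:
  assumes c: "c < n"
  shows "B c \<le> k \<Longrightarrow> wedge (c, k) (ket B) = 0"
    and "wedge (c, B c - 1) (ket B) = scale (other_sign c B * lower_sign c B) (ket (B - delta c))"
proof -
  have *: "wedge (c, k) (ket B) = scale (other_sign c B) (QP_inv B (wedge (c, k - B c) (vac n)))" for k
    unfolding ket_def by (rule QP_inv_graded[OF graded_family_wedge[OF c] vac_Fock])
  show "wedge (c, k) (ket B) = 0" if "B c \<le> k"
    using that c by (simp add: * wedge_vac fock_auto_zero[OF fock_auto_QP_inv])
  show "wedge (c, B c - 1) (ket B) = scale (other_sign c B * lower_sign c B) (ket (B - delta c))"
    unfolding * by (simp add: ket_def Q_vac[OF c, symmetric] QP_inv_Q[OF c vac_Fock])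
qed

lemma ket_contract:
  assumes c: "c < n"
  shows "k < B c \<Longrightarrow> contract (c, k) (ket B) = 0"
    and "contract (c, B c) (ket B) = scale (other_sign c B * lower_sign c B) (ket (B + delta c))"
proof -
  have *: "contract (c, k) (ket B) = scale (other_sign c B) (QP_inv B (contract (c, k - B c) (vac n)))" for k
    unfolding ket_def by (rule QP_inv_graded[OF graded_family_contract[OF c] vac_Fock])
  show "contract (c, k) (ket B) = 0" if "k < B c"
    using that by (simp add: * contract_vac fock_auto_zero[OF fock_auto_QP_inv])
  have eq: "B + delta c - delta c = B" by (rule ext) simp
  have "ket (B + delta c) = QP_inv (B + delta c) (Q c (contract (c, 0) (vac n)))"
    unfolding ket_def Q_inv_vac'[OF c] ..
  also have "\<dots> = scale (lower_sign c B) (QP_inv B (contract (c, 0) (vac n)))"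
    unfolding QP_inv_Q[OF c Q_inv_vac'(1)[OF c]] eq sign_simps ..
  finally show "contract (c, B c) (ket B) = scale (other_sign c B * lower_sign c B) (ket (B + delta c))"
    by (simp add: * mult.assoc)
qed

text \<open>Since \<open>T^\<kappa> = Q^{-\<kappa>}\<close>, the filling level of colour
  \<open>c\<close> in the bra is \<open>B c + \<kappa> c\<close>. The mode passes through two
  translation products, so two of the signs come from moving and one from absorption.\<close>

lemma bra_wedge:
  assumes c: "c < n"
  shows "B c + \<kappa> c \<le> k \<Longrightarrow> wedge (c, k) (bra \<kappa> B) = 0"
    and "wedge (c, B c + \<kappa> c - 1) (bra \<kappa> B) = scale (other_sign c B * lower_sign c \<kappa>) (bra (\<kappa> - delta c) B)"
proof -
  have *: "wedge (c, k) (bra \<kappa> B) = scale (other_sign c B) (QP_inv B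
      (scale (other_sign c \<kappa>) (QP (- \<kappa>) (wedge (c, k - B c - \<kappa> c) (vac n)))))" for k
    unfolding bra_def QP_inv_graded[OF graded_family_wedge[OF c] QP_closed[OF vac_Fock]]
      QP_graded[OF graded_family_wedge[OF c] vac_Fock] by simp
  show "wedge (c, k) (bra \<kappa> B) = 0" if "B c + \<kappa> c \<le> k"
    using that c by (simp add: * wedge_vac fock_auto_zero[OF fock_auto_QP] fock_auto_zero[OF fock_auto_QP_inv])
  have eq: "- \<kappa> + delta c = - (\<kappa> - delta c)" by (rule ext) simp
  have "QP (- \<kappa>) (wedge (c, - 1) (vac n)) =
      scale (other_sign c \<kappa> * lower_sign c \<kappa>) (QP (- (\<kappa> - delta c)) (vac n))"
    unfolding Q_vac[OF c, symmetric] QP_Q[OF c vac_Fock] eq sign_simps ..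
  then show "wedge (c, B c + \<kappa> c - 1) (bra \<kappa> B) = scale (other_sign c B * lower_sign c \<kappa>) (bra (\<kappa> - delta c) B)"
    unfolding * by (simp add: bra_def fock_auto_scale[OF fock_auto_QP_inv] QP_closed[OF vac_Fock] mult.assoc[symmetric])
qed

lemma bra_contract:
  assumes c: "c < n"
  shows "k < B c + \<kappa> c \<Longrightarrow> contract (c, k) (bra \<kappa> B) = 0"
    and "contract (c, B c + \<kappa> c) (bra \<kappa> B) = scale (other_sign c B * lower_sign c \<kappa>) (bra (\<kappa> + delta c) B)"
proof -
  have *: "contract (c, k) (bra \<kappa> B) = scale (other_sign c B) (QP_inv B
      (scale (other_sign c \<kappa>) (QP (- \<kappa>) (contract (c, k - B c - \<kappa> c) (vac n)))))" for k
    unfolding bra_def QP_inv_graded[OF graded_family_contract[OF c] QP_closed[OF vac_Fock]]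
      QP_graded[OF graded_family_contract[OF c] vac_Fock] by simp
  show "contract (c, k) (bra \<kappa> B) = 0" if "k < B c + \<kappa> c"
    using that by (simp add: * contract_vac fock_auto_zero[OF fock_auto_QP] fock_auto_zero[OF fock_auto_QP_inv])
  let ?y = "contract (c, 0) (vac n)"
  have eq: "- (\<kappa> + delta c) + delta c = - \<kappa>" by (rule ext) simp
  have "QP (- (\<kappa> + delta c)) (vac n) = QP (- (\<kappa> + delta c)) (Q c ?y)"
    unfolding Q_inv_vac'(2)[OF c] ..
  also have "\<dots> = scale (other_sign c \<kappa> * lower_sign c \<kappa>) (QP (- \<kappa>) ?y)"
    unfolding QP_Q[OF c Q_inv_vac'(1)[OF c]] eq sign_simps ..
  finally have "bra (\<kappa> + delta c) B = scale (other_sign c \<kappa> * lower_sign c \<kappa>) (QP_inv B (QP (- \<kappa>) ?y))"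
    unfolding bra_def by (simp add: fock_auto_scale[OF fock_auto_QP_inv] QP_closed[OF Q_inv_vac'(1)[OF c]])
  then have "scale (other_sign c B * lower_sign c \<kappa>) (bra (\<kappa> + delta c) B) =
      scale (other_sign c B * other_sign c \<kappa> * (lower_sign c \<kappa> * lower_sign c \<kappa>)) (QP_inv B (QP (- \<kappa>) ?y))"
    by (simp add: mult.assoc mult.left_commute[of "lower_sign c \<kappa>"] del: sign_simps)
  then show "contract (c, B c + \<kappa> c) (bra \<kappa> B) = scale (other_sign c B * lower_sign c \<kappa>) (bra (\<kappa> + delta c) B)"
    unfolding * by (simp add: fock_auto_scale[OF fock_auto_QP_inv] QP_closed[OF Q_inv_vac'(1)[OF c]])
qed

text \<open>For \<open>B = C + \<delta>\<^sub>I - \<delta>\<^sub>J\<close> only the sites \<open>(c, C c)\<close> with \<open>c \<in> I\<close> are filled in the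
  second ket and empty in the first.\<close>

lemma Omega_ket:
  assumes I: "I \<subseteq> {0..<n}" and B: "\<And>c. c < n \<Longrightarrow> B c = (if c \<in> I then C c + 1 else C c - 1)"
    and S: "semi_infinite n S" "semi_infinite n T"
  shows "Omega (\<lambda>S T. ket B S * ket C T) S T =
    (\<Sum>c\<in>I. other_sign c B * lower_sign c B * (other_sign c C * lower_sign c C) *
       (ket (B - delta c) S * ket (C + delta c) T))"
proof -
  let ?Z = "(\<lambda>c. (c, C c)) ` I"
  let ?h = "\<lambda>z. wedge z (ket B) S * contract z (ket C) T"
  have fin: "finite ?Z" "finite (S - T)"
    using I S by (auto intro: finite_subset finite_semi_infinite_diff)
  have "(\<Sum>z\<in>S - T. ?h z) = (\<Sum>z\<in>(S - T) \<union> ?Z. ?h z)"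
    by (rule sum.mono_neutral_left) (use fin in \<open>auto simp: wedge_def contract_def\<close>)
  also have "\<dots> = (\<Sum>z\<in>?Z. ?h z)"
  proof (rule sum.mono_neutral_right)
    show "\<forall>z\<in>S - T \<union> ?Z - ?Z. ?h z = 0"
    proof
      fix z assume z: "z \<in> S - T \<union> ?Z - ?Z"
      obtain c k where ck: "z = (c, k)" by force
      have c: "c < n" using z S(1) ck by (auto simp: semi_infinite_def)
      have "k \<noteq> C c \<or> c \<notin> I" using z ck by auto
      then have "B c \<le> k \<or> k < C c" using B[OF c] by (auto split: if_splits)
      then show "?h z = 0"
        using ket_wedge(1)[OF c, of B k] ket_contract(1)[OF c, of k C] ck by auto
    qed
  qed (use fin in auto)
  also have "\<dots> = (\<Sum>c\<in>I. ?h (c, C c))"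
    by (subst sum.reindex) (auto simp: inj_on_def)
  also have "\<dots> = (\<Sum>c\<in>I. other_sign c B * lower_sign c B * (other_sign c C * lower_sign c C) *
       (ket (B - delta c) S * ket (C + delta c) T))"
  proof (intro sum.cong refl)
    fix c assume c: "c \<in> I"
    then have n: "c < n" using I by auto
    have "C c = B c - 1" using B[OF n] c by simp
    then have "wedge (c, C c) (ket B) = scale (other_sign c B * lower_sign c B) (ket (B - delta c))"
      using ket_wedge(2)[OF n] by simp
    then show "?h (c, C c) = other_sign c B * lower_sign c B * (other_sign c C * lower_sign c C) *
       (ket (B - delta c) S * ket (C + delta c) T)"
      unfolding ket_contract(2)[OF n] by (simp add: scale_def mult_ac)
  qed
  finally show ?thesis unfolding Omega_tensor .
qed

section \<open>The identity for formal series\<close>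

lemma delta_set_apply: "finite I \<Longrightarrow> delta_set I i = (if i \<in> I then 1 else 0)"
proof -
  have "delta_set I i = (\<Sum>j\<in>I. delta j i)"
    unfolding delta_set_def by (induction I rule: infinite_finite_induct) auto
  then show "finite I \<Longrightarrow> ?thesis" by (simp add: delta_def)
qed

lemma sum_series_apply: "(\<Sum>i\<in>A. f i) m = (\<Sum>i\<in>A. (f i :: pseries) m)"
  by (induction A rule: infinite_finite_induct) auto

lemma tau_identity:
  assumes I: "I \<subseteq> {0..<n}" and J: "J = {0..<n} - I" and a: "a \<in> I"
  shows "tau n Q \<kappa> (\<beta> + delta_set I) \<star> tau n Q \<kappa> (\<beta> + delta_set J)
       + (\<Sum>b\<in>J. tau n Q (\<kappa> + delta b - delta a) (\<beta> + delta_set I)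
              \<star> tau n Q (\<kappa> + delta a - delta b) (\<beta> + delta_set J))
     = (\<Sum>a''\<in>I. tau n Q (\<kappa> + delta a'' - delta a) (\<beta> + delta_set I - delta a'')
              \<star> tau n Q (\<kappa> + delta a - delta a'') (\<beta> + delta_set J + delta a''))"
proof
  fix m
  define B where "B = \<beta> + delta_set I"
  define C where "C = \<beta> + delta_set J"
  \<comment> \<open>A contraction of colour \<open>c\<close> turns \<open>\<mu>\<close> into
    \<open>\<kappa> + delta c - delta a\<close>, and a wedging turns \<open>\<nu>\<close> into
    \<open>\<kappa> + delta a - delta c\<close>. For \<open>c = a\<close> both are
    \<open>\<kappa>\<close>, which is the first product of the identity.\<close>
  define \<mu> where "\<mu> = \<kappa> - delta a"
  define \<nu> where "\<nu> = \<kappa> + delta a"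
  let ?G = "group_element n"
  have fin: "finite I" "finite J" using I J by (auto intro: finite_subset)
  have an: "a < n" using a I by auto
  have Bc: "B c = \<beta> c + (if c \<in> I then 1 else 0)" and Cc: "C c = \<beta> c + (if c \<in> J then 1 else 0)" for c
    by (simp_all add: B_def C_def delta_set_apply fin)
  define e where "e = parity_sign (int n - 1)"
  \<comment> \<open>Away from \<open>c\<close> the entries of \<open>B\<close> and \<open>C\<close>
    add up to \<open>2 * \<beta> i + 1\<close>, and there are \<open>n - 1\<close> of them;
    \<open>\<mu>\<close> and \<open>\<nu>\<close> add up to \<open>2 * \<kappa>\<close>. So the sign
    is the same for every colour.\<close>
  have sgn: "other_sign c B * other_sign c C * (lower_sign c \<mu> * lower_sign c \<nu>) = e" if "c < n" for c
  proof -
    have "sum B ({0..<n} - {c}) + sum C ({0..<n} - {c}) = (\<Sum>i\<in>{0..<n} - {c}. 2 * \<beta> i + 1)"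
      unfolding sum.distrib[symmetric] by (rule sum.cong) (use J in \<open>auto simp: Bc Cc\<close>)
    also have "\<dots> = 2 * (\<Sum>i\<in>{0..<n} - {c}. \<beta> i) + (int n - 1)"
      using that by (simp add: sum.distrib sum_distrib_left of_nat_diff)
    finally have 1: "other_sign c B * other_sign c C = e"
      unfolding other_sign_def parity_sign_add[symmetric] e_def by (simp add: parity_sign_def)
    have "sum \<mu> {0..<c} + sum \<nu> {0..<c} = 2 * sum \<kappa> {0..<c}"
      unfolding sum.distrib[symmetric] sum_distrib_left by (rule sum.cong) (auto simp: \<mu>_def \<nu>_def)
    then have "lower_sign c \<mu> * lower_sign c \<nu> = 1"
      unfolding lower_sign_def parity_sign_add[symmetric] by (simp add: parity_sign_def)
    with 1 show ?thesis by simp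
  qed
  let ?u = "bra \<mu> B" and ?u' = "bra \<nu> C"
  \<comment> \<open>In colour \<open>c\<close> the contraction needs a mode at least
    \<open>B c + \<mu> c\<close> and the wedging a mode below \<open>C c + \<nu> c\<close>. The gap
    is \<open>1\<close> for \<open>c\<close> in \<open>J\<close>, where \<open>C\<close> exceeds
    \<open>B\<close> by one; it is \<open>- 1 + 2 = 1\<close> for \<open>c = a\<close>, and
    \<open>- 1\<close> for the rest of \<open>I\<close>. Where a site exists it is the boundary site
    of both bras.\<close>
  let ?Z = "(\<lambda>c. (c, B c + \<mu> c)) ` insert a J"
  have BC: "B c = (if c \<in> I then C c + 1 else C c - 1)" if "c < n" for c
    using that J by (auto simp: Bc Cc)
  have site: "B c + \<mu> c = C c + \<nu> c - 1" if "c \<in> insert a J" for c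
    using that J a by (auto simp: Bc Cc \<mu>_def \<nu>_def delta_def)
  have "(\<Sum>z\<in>?Z. \<Sum>(p, q) | p + q = m. inner (contract z ?u) (?G (ket B) p) * inner (wedge z ?u') (?G (ket C) q)) =
    (\<Sum>c\<in>I. other_sign c B * lower_sign c B * (other_sign c C * lower_sign c C) *
      (\<Sum>(p, q) | p + q = m. inner ?u (?G (ket (B - delta c)) p) * inner ?u' (?G (ket (C + delta c)) q)))"
  proof (rule group_element_bilinear[OF signed_monomial_bra signed_monomial_bra Omega_ket[OF I BC]])
    show "contract z ?u = 0 \<or> wedge z ?u' = 0" if z: "fst z < n" "z \<notin> ?Z" for z
    proof -
      obtain c k where ck: "z = (c, k)" by force
      have c: "c < n" and "c \<in> insert a J \<Longrightarrow> k \<noteq> B c + \<mu> c" using z ck by auto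
      then have "k < B c + \<mu> c \<or> C c + \<nu> c \<le> k"
        using site[of c] J by (cases "c \<in> insert a J") (auto simp: Bc Cc \<mu>_def \<nu>_def delta_def)
      then show ?thesis using bra_contract(1)[OF c] bra_wedge(1)[OF c] ck by blast
    qed
  qed (use fin in auto)
  also have "(\<Sum>z\<in>?Z. \<Sum>(p, q) | p + q = m. inner (contract z ?u) (?G (ket B) p) * inner (wedge z ?u') (?G (ket C) q)) =
     (\<Sum>c\<in>insert a J. e * (tau n Q (\<mu> + delta c) B \<star> tau n Q (\<nu> - delta c) C) m)"
  proof (subst sum.reindex, goal_cases)
    case 2
    show ?case
    proof (intro sum.cong refl)
      fix c assume c: "c \<in> insert a J"
      then have n: "c < n" using an J by auto
      have s: "other_sign c B * lower_sign c \<mu> * (other_sign c C * lower_sign c \<nu>) = e"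
        using sgn[OF n] by (simp add: mult_ac)
      have 1: "inner (contract (c, B c + \<mu> c) ?u) x = other_sign c B * lower_sign c \<mu> * inner (bra (\<mu> + delta c) B) x" for x
        unfolding bra_contract(2)[OF n] inner_scale_left ..
      have 2: "inner (wedge (c, B c + \<mu> c) ?u') x = other_sign c C * lower_sign c \<nu> * inner (bra (\<nu> - delta c) C) x" for x
        unfolding site[OF c] bra_wedge(2)[OF n] inner_scale_left ..
      show "((\<lambda>z. \<Sum>(p, q) | p + q = m. inner (contract z ?u) (?G (ket B) p) * inner (wedge z ?u') (?G (ket C) q)) \<circ> (\<lambda>c. (c, B c + \<mu> c))) c
        = e * (tau n Q (\<mu> + delta c) B \<star> tau n Q (\<nu> - delta c) C) m"
        unfolding comp_apply 1 2 series_mult_def tau_eq s[symmetric] sum_distrib_left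
        by (rule sum.cong) (simp_all add: case_prod_unfold mult_ac)
    qed
  qed (auto simp: inj_on_def)
  also have "\<dots> = e * (tau n Q (\<mu> + delta a) B \<star> tau n Q (\<nu> - delta a) C) m +
      (\<Sum>c\<in>J. e * (tau n Q (\<mu> + delta c) B \<star> tau n Q (\<nu> - delta c) C) m)"
    using fin a J by (subst sum.insert) auto
  also have "\<dots> = e * ((tau n Q (\<mu> + delta a) B \<star> tau n Q (\<nu> - delta a) C) m +
      (\<Sum>c\<in>J. (tau n Q (\<mu> + delta c) B \<star> tau n Q (\<nu> - delta c) C) m))"
    by (simp add: algebra_simps sum_distrib_left)
  also have "(\<Sum>c\<in>I. other_sign c B * lower_sign c B * (other_sign c C * lower_sign c C) *
      (\<Sum>(p, q) | p + q = m. inner ?u (?G (ket (B - delta c)) p) * inner ?u' (?G (ket (C + delta c)) q))) =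
    e * (\<Sum>c\<in>I. (tau n Q (\<mu> + delta c) (B - delta c) \<star> tau n Q (\<nu> - delta c) (C + delta c)) m)"
    unfolding sum_distrib_left[of e]
  proof (intro sum.cong refl)
    fix c assume c: "c \<in> I"
    then have n: "c < n" using I by auto
    \<comment> \<open>The kets now have exponents \<open>B - delta c\<close> and
      \<open>C + delta c\<close>, so the bras are rewritten to match. Each \<open>lower_sign\<close>
      of \<open>B\<close> and \<open>C\<close> from the kets meets its equal from the bras, leaving
      \<open>e\<close>.\<close>
    have 1: "inner ?u x = lower_sign c \<mu> * lower_sign c B * inner (bra (\<mu> + delta c) (B - delta c)) x" for x
      by (subst bra_shift[OF n]) (rule inner_scale_left)
    have 2: "inner ?u' x = lower_sign c \<nu> * lower_sign c C * inner (bra (\<nu> - delta c) (C + delta c)) x" for x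
      by (subst bra_shift'[OF n]) (rule inner_scale_left)
    have "other_sign c B * lower_sign c B * (other_sign c C * lower_sign c C) * (lower_sign c \<mu> * lower_sign c B * (lower_sign c \<nu> * lower_sign c C))
       = (other_sign c B * other_sign c C * (lower_sign c \<mu> * lower_sign c \<nu>)) * (lower_sign c B * lower_sign c B) * (lower_sign c C * lower_sign c C)"
      by (simp only: mult_ac)
    also have "\<dots> = e" unfolding sgn[OF n] sign_simps by simp
    finally have s: "other_sign c B * lower_sign c B * (other_sign c C * lower_sign c C) *
      (lower_sign c \<mu> * lower_sign c B * (lower_sign c \<nu> * lower_sign c C)) = e" .
    show "other_sign c B * lower_sign c B * (other_sign c C * lower_sign c C) *
        (\<Sum>(p, q) | p + q = m. inner ?u (?G (ket (B - delta c)) p) * inner ?u' (?G (ket (C + delta c)) q)) =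
      e * (tau n Q (\<mu> + delta c) (B - delta c) \<star> tau n Q (\<nu> - delta c) (C + delta c)) m"
      unfolding 1 2 series_mult_def tau_eq s[symmetric] sum_distrib_left
      by (rule sum.cong) (simp_all add: case_prod_unfold mult_ac)
  qed
  \<comment> \<open>The common factor \<open>e\<close> is \<open>1\<close> or \<open>- 1\<close> and
    is cancelled.\<close>
  finally have main: "(tau n Q (\<mu> + delta a) B \<star> tau n Q (\<nu> - delta a) C) m +
      (\<Sum>c\<in>J. (tau n Q (\<mu> + delta c) B \<star> tau n Q (\<nu> - delta c) C) m) =
      (\<Sum>c\<in>I. (tau n Q (\<mu> + delta c) (B - delta c) \<star> tau n Q (\<nu> - delta c) (C + delta c)) m)"
    by (simp add: e_def parity_sign_def split: if_splits)
  have eqs: "\<mu> + delta a = \<kappa>" "\<nu> - delta a = \<kappa>" "\<kappa> + delta a - delta a = \<kappa>"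
    "\<mu> + delta c = \<kappa> + delta c - delta a" "\<nu> - delta c = \<kappa> + delta a - delta c" for c
    by (simp_all only: \<mu>_def \<nu>_def) (rule ext, simp)+
  show "(tau n Q \<kappa> (\<beta> + delta_set I) \<star> tau n Q \<kappa> (\<beta> + delta_set J)
       + (\<Sum>b\<in>J. tau n Q (\<kappa> + delta b - delta a) (\<beta> + delta_set I)
              \<star> tau n Q (\<kappa> + delta a - delta b) (\<beta> + delta_set J))) m
     = (\<Sum>a''\<in>I. tau n Q (\<kappa> + delta a'' - delta a) (\<beta> + delta_set I - delta a'')
              \<star> tau n Q (\<kappa> + delta a - delta a'') (\<beta> + delta_set J + delta a'')) m"
    using main unfolding plus_fun_apply[of "_ \<star> _"] sum_series_apply B_def[symmetric] C_def[symmetric] eqs .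
qed

lemma tau_multilinear:
  assumes "tau n Q \<kappa> B m \<noteq> 0"
  shows "Poly_Mapping.lookup m x \<le> 1"
proof -
  have "group_element n (ket B) m \<noteq> 0"
    using assms by (auto simp: tau_eq)
  then show ?thesis by (rule group_element_multilinear)
qed

end

section \<open>Specialisation of the variables\<close>

definition evaluate :: "(var \<Rightarrow> complex) \<Rightarrow> expo \<Rightarrow> complex" where
  "evaluate \<gamma> m = (\<Prod>x\<in>Poly_Mapping.keys m. \<gamma> x ^ Poly_Mapping.lookup m x)"

lemma evaluate_superset:
  "finite A \<Longrightarrow> Poly_Mapping.keys m \<subseteq> A \<Longrightarrow> evaluate \<gamma> m = (\<Prod>x\<in>A. \<gamma> x ^ Poly_Mapping.lookup m x)"
  unfolding evaluate_def by (rule prod.mono_neutral_left) (auto simp: in_keys_iff)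

lemma evaluate_add: "evaluate \<gamma> (p + q) = evaluate \<gamma> p * evaluate \<gamma> q"
proof -
  let ?A = "Poly_Mapping.keys p \<union> Poly_Mapping.keys q"
  have "evaluate \<gamma> (p + q) = (\<Prod>x\<in>?A. \<gamma> x ^ Poly_Mapping.lookup (p + q) x)"
    by (rule evaluate_superset[OF _ Poly_Mapping.keys_add]) simp
  moreover have "evaluate \<gamma> p = (\<Prod>x\<in>?A. \<gamma> x ^ Poly_Mapping.lookup p x)"
    "evaluate \<gamma> q = (\<Prod>x\<in>?A. \<gamma> x ^ Poly_Mapping.lookup q x)"
    by (rule evaluate_superset; auto)+
  ultimately show ?thesis by (simp add: lookup_add power_add prod.distrib)
qed

lemma evaluate_nonzeroD: "evaluate \<gamma> m \<noteq> 0 \<Longrightarrow> Poly_Mapping.keys m \<subseteq> {x. \<gamma> x \<noteq> 0}"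
  by (auto simp: evaluate_def in_keys_iff)

text \<open>\<open>specialise\<close> is a finite sum and takes the default value zero if infinitely
  many terms survive. Additivity and multiplicativity are therefore proved for series with finitely
  many surviving terms.\<close>

definition specialisable :: "(var \<Rightarrow> complex) \<Rightarrow> pseries \<Rightarrow> bool" where
  "specialisable \<gamma> f \<longleftrightarrow> finite {m. evaluate \<gamma> m \<noteq> 0 \<and> f m \<noteq> 0}"

lemma specialise_superset:
  assumes "finite F" "\<And>m. evaluate \<gamma> m \<noteq> 0 \<Longrightarrow> f m \<noteq> 0 \<Longrightarrow> m \<in> F"
  shows "specialise \<gamma> f = (\<Sum>m\<in>F. f m * evaluate \<gamma> m)"
proof -
  \<comment> \<open>Exponents on keys are positive, so a monomial evaluates to a nonzero number
    exactly when all its variables do.\<close>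
  have *: "{m. Poly_Mapping.keys m \<subseteq> {x. \<gamma> x \<noteq> 0} \<and> f m \<noteq> 0} = {m. evaluate \<gamma> m \<noteq> 0 \<and> f m \<noteq> 0}"
    using evaluate_nonzeroD by (auto simp: evaluate_def)
  show ?thesis
    unfolding specialise_def * evaluate_def[symmetric]
    by (rule sum.mono_neutral_left) (use assms in auto)
qed

lemma series_mult_support:
  assumes "evaluate \<gamma> m \<noteq> 0" "(f \<star> g) m \<noteq> 0"
  shows "\<exists>p q. m = p + q \<and> evaluate \<gamma> p \<noteq> 0 \<and> f p \<noteq> 0 \<and> evaluate \<gamma> q \<noteq> 0 \<and> g q \<noteq> 0"
proof -
  obtain x where "x \<in> {(p, q). p + q = m}" "(case x of (p, q) \<Rightarrow> f p * g q) \<noteq> 0"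
    using assms(2) unfolding series_mult_def by (meson sum.neutral)
  then obtain p q where "m = p + q" "f p \<noteq> 0" "g q \<noteq> 0" by auto
  then show ?thesis using assms(1) evaluate_add by (metis mult_eq_0_iff)
qed

lemma specialisable_mult:
  assumes "specialisable \<gamma> f" "specialisable \<gamma> g"
  shows "specialisable \<gamma> (f \<star> g)"
proof -
  have "{m. evaluate \<gamma> m \<noteq> 0 \<and> (f \<star> g) m \<noteq> 0} \<subseteq> (\<lambda>(p, q). p + q) `
      ({m. evaluate \<gamma> m \<noteq> 0 \<and> f m \<noteq> 0} \<times> {m. evaluate \<gamma> m \<noteq> 0 \<and> g m \<noteq> 0})"
    using series_mult_support by fastforce
  then show ?thesis using assms unfolding specialisable_def by (meson finite_SigmaI finite_imageI finite_subset)
qed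

lemma specialise_mult:
  assumes "specialisable \<gamma> f" "specialisable \<gamma> g"
  shows "specialise \<gamma> (f \<star> g) = specialise \<gamma> f * specialise \<gamma> g"
proof -
  let ?F = "{m. evaluate \<gamma> m \<noteq> 0 \<and> f m \<noteq> 0}" and ?G = "{m. evaluate \<gamma> m \<noteq> 0 \<and> g m \<noteq> 0}"
  \<comment> \<open>By \<open>series_mult_support\<close>, every surviving exponent of the product
    is a sum of surviving exponents of the factors. The double sum over pairs is then grouped by the
    value of this sum.\<close>
  let ?H = "(\<lambda>(p, q). p + q) ` (?F \<times> ?G)"
  have fin: "finite ?F" "finite ?G" "finite ?H" using assms by (simp_all add: specialisable_def)
  have "specialise \<gamma> (f \<star> g) = (\<Sum>m\<in>?H. (f \<star> g) m * evaluate \<gamma> m)"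
    by (rule specialise_superset) (use fin series_mult_support in fastforce)+
  also have "\<dots> = (\<Sum>m\<in>?H. \<Sum>x\<in>{x \<in> ?F \<times> ?G. (case x of (p, q) \<Rightarrow> p + q) = m}.
      case x of (p, q) \<Rightarrow> (f p * evaluate \<gamma> p) * (g q * evaluate \<gamma> q))"
  proof (intro sum.cong refl)
    fix m
    let ?X = "{x \<in> ?F \<times> ?G. (case x of (p, q) \<Rightarrow> p + q) = m}"
    have "(f \<star> g) m * evaluate \<gamma> m = (\<Sum>(p, q) | p + q = m. (f p * evaluate \<gamma> p) * (g q * evaluate \<gamma> q))"
      unfolding series_mult_def sum_distrib_right
      by (rule sum.cong) (auto simp: evaluate_add)
    also have "\<dots> = (\<Sum>(p, q)\<in>?X. (f p * evaluate \<gamma> p) * (g q * evaluate \<gamma> q))"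
      by (rule sum.mono_neutral_right) (auto simp: finite_decompositions)
    finally show "(f \<star> g) m * evaluate \<gamma> m = \<dots>" .
  qed
  also have "\<dots> = (\<Sum>(p, q)\<in>?F \<times> ?G. (f p * evaluate \<gamma> p) * (g q * evaluate \<gamma> q))"
    using fin by (subst sum.image_gen[of "?F \<times> ?G" _ "\<lambda>(p, q). p + q"]) auto
  also have "\<dots> = (\<Sum>p\<in>?F. f p * evaluate \<gamma> p) * (\<Sum>q\<in>?G. g q * evaluate \<gamma> q)"
    by (simp add: sum_product sum.cartesian_product)
  also have "\<dots> = specialise \<gamma> f * specialise \<gamma> g"
    using specialise_superset[of ?F \<gamma> f] specialise_superset[of ?G \<gamma> g] fin by simp
  finally show ?thesis .
qed

lemma specialisable_add: "specialisable \<gamma> f \<Longrightarrow> specialisable \<gamma> g \<Longrightarrow> specialisable \<gamma> (f + g)"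
  and specialise_add:
    "specialisable \<gamma> f \<Longrightarrow> specialisable \<gamma> g \<Longrightarrow> specialise \<gamma> (f + g) = specialise \<gamma> f + specialise \<gamma> g"
proof -
  assume fg: "specialisable \<gamma> f" "specialisable \<gamma> g"
  let ?F = "{m. evaluate \<gamma> m \<noteq> 0 \<and> f m \<noteq> 0} \<union> {m. evaluate \<gamma> m \<noteq> 0 \<and> g m \<noteq> 0}"
  have fin: "finite ?F" using fg by (simp add: specialisable_def)
  have "{m. evaluate \<gamma> m \<noteq> 0 \<and> (f + g) m \<noteq> 0} \<subseteq> ?F" by auto
  then show "specialisable \<gamma> (f + g)" unfolding specialisable_def using fin by (rule finite_subset)
  have "specialise \<gamma> (f + g) = (\<Sum>m\<in>?F. (f + g) m * evaluate \<gamma> m)"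
    "specialise \<gamma> f = (\<Sum>m\<in>?F. f m * evaluate \<gamma> m)" "specialise \<gamma> g = (\<Sum>m\<in>?F. g m * evaluate \<gamma> m)"
    by (rule specialise_superset[OF fin]; auto)+
  then show "specialise \<gamma> (f + g) = specialise \<gamma> f + specialise \<gamma> g"
    by (simp add: distrib_right sum.distrib)
qed

lemma specialisable_sum: "(\<And>i. i \<in> A \<Longrightarrow> specialisable \<gamma> (f i)) \<Longrightarrow> specialisable \<gamma> (\<Sum>i\<in>A. f i)"
  and specialise_sum: "(\<And>i. i \<in> A \<Longrightarrow> specialisable \<gamma> (f i)) \<Longrightarrow> specialise \<gamma> (\<Sum>i\<in>A. f i) = (\<Sum>i\<in>A. specialise \<gamma> (f i))"
proof -
  have z: "specialisable \<gamma> 0" "specialise \<gamma> 0 = 0" by (simp_all add: specialisable_def specialise_def)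
  have "specialisable \<gamma> (\<Sum>i\<in>A. f i) \<and> specialise \<gamma> (\<Sum>i\<in>A. f i) = (\<Sum>i\<in>A. specialise \<gamma> (f i))"
    if "\<And>i. i \<in> A \<Longrightarrow> specialisable \<gamma> (f i)"
    using that
  proof (induction A rule: infinite_finite_induct)
    case (insert i A)
    then have "specialisable \<gamma> (f i)" "specialisable \<gamma> (sum f A)" by auto
    then show ?case using insert
      unfolding sum.insert[OF insert(1,2)] by (simp add: specialisable_add specialise_add del: plus_fun_apply)
  qed (use z in simp_all)
  then show "(\<And>i. i \<in> A \<Longrightarrow> specialisable \<gamma> (f i)) \<Longrightarrow> specialisable \<gamma> (\<Sum>i\<in>A. f i)"
    "(\<And>i. i \<in> A \<Longrightarrow> specialisable \<gamma> (f i)) \<Longrightarrow> specialise \<gamma> (\<Sum>i\<in>A. f i) = (\<Sum>i\<in>A. specialise \<gamma> (f i))"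
    by blast+
qed

text \<open>A squarefree monomial is determined by the set of its variables, so there are at most as
  many as subsets of \<open>X\<close>. With multilinearity of \<open>\<tau>\<close> this makes
  specialisation a genuinely finite sum.\<close>

lemma finite_multilinear_exponents:
  assumes "finite X"
  shows "finite {m :: expo. Poly_Mapping.keys m \<subseteq> X \<and> (\<forall>x. Poly_Mapping.lookup m x \<le> 1)}"
proof -
  have "inj_on Poly_Mapping.keys {m :: expo. Poly_Mapping.keys m \<subseteq> X \<and> (\<forall>x. Poly_Mapping.lookup m x \<le> 1)}"
  proof (rule inj_onI, rule poly_mapping_eqI)
    fix m m' :: expo and x
    assume "m \<in> {m. Poly_Mapping.keys m \<subseteq> X \<and> (\<forall>x. Poly_Mapping.lookup m x \<le> 1)}"
      "m' \<in> {m. Poly_Mapping.keys m \<subseteq> X \<and> (\<forall>x. Poly_Mapping.lookup m x \<le> 1)}"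
      "Poly_Mapping.keys m = Poly_Mapping.keys m'"
    moreover from this have "Poly_Mapping.lookup m x = 0 \<longleftrightarrow> Poly_Mapping.lookup m' x = 0"
      by (simp add: in_keys_iff[symmetric] flip: not_in_keys_iff_lookup_eq_zero)
    ultimately show "Poly_Mapping.lookup m x = Poly_Mapping.lookup m' x"
      by (metis (mono_tags, lifting) le_antisym less_one mem_Collect_eq not_le)
  qed
  moreover have "Poly_Mapping.keys ` {m :: expo. Poly_Mapping.keys m \<subseteq> X \<and> (\<forall>x. Poly_Mapping.lookup m x \<le> 1)} \<subseteq> Pow X"
    by auto
  ultimately show ?thesis using assms by (meson finite_Pow_iff finite_imageD finite_subset)
qed

lemma (in translation_system) specialisable_tau:
  assumes "finite {x. \<gamma> x \<noteq> 0}"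
  shows "specialisable \<gamma> (tau n Q \<kappa> B)"
proof -
  have "{m. evaluate \<gamma> m \<noteq> 0 \<and> tau n Q \<kappa> B m \<noteq> 0} \<subseteq>
      {m. Poly_Mapping.keys m \<subseteq> {x. \<gamma> x \<noteq> 0} \<and> (\<forall>x. Poly_Mapping.lookup m x \<le> 1)}"
    using evaluate_nonzeroD tau_multilinear by blast
  then show ?thesis
    unfolding specialisable_def using finite_multilinear_exponents[OF assms] by (rule finite_subset)
qed

theorem theorem15p3:
  fixes n :: nat
    and Q :: "nat \<Rightarrow> fock \<Rightarrow> fock"
    and \<kappa> \<beta> :: "nat \<Rightarrow> int"
    and I J :: "nat set"
    and a :: nat
  assumes "n \<ge> 2"
    and "translation_operators n Q"
    and "\<kappa> \<in> root_lattice n"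
    and "\<beta> \<in> int_lattice n"
    and "I \<subset> {0..<n}" and "I \<noteq> {}"
    and "J = {0..<n} - I"
    and "a \<in> I"
  shows
    "tau n Q \<kappa> (\<beta> + delta_set I) \<star> tau n Q \<kappa> (\<beta> + delta_set J)
       + (\<Sum>b\<in>J. tau n Q (\<kappa> + delta b - delta a) (\<beta> + delta_set I)
              \<star> tau n Q (\<kappa> + delta a - delta b) (\<beta> + delta_set J))
     = (\<Sum>a''\<in>I. tau n Q (\<kappa> + delta a'' - delta a) (\<beta> + delta_set I - delta a'')
              \<star> tau n Q (\<kappa> + delta a - delta a'') (\<beta> + delta_set J + delta a''))
     \<and> (\<forall>\<gamma>. finite {x. \<gamma> x \<noteq> 0} \<longrightarrow>
          specialise \<gamma> (tau n Q \<kappa> (\<beta> + delta_set I)) * specialise \<gamma> (tau n Q \<kappa> (\<beta> + delta_set J))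
            + (\<Sum>b\<in>J. specialise \<gamma> (tau n Q (\<kappa> + delta b - delta a) (\<beta> + delta_set I))
                   * specialise \<gamma> (tau n Q (\<kappa> + delta a - delta b) (\<beta> + delta_set J)))
          = (\<Sum>a''\<in>I. specialise \<gamma> (tau n Q (\<kappa> + delta a'' - delta a) (\<beta> + delta_set I - delta a''))
                   * specialise \<gamma> (tau n Q (\<kappa> + delta a - delta a'') (\<beta> + delta_set J + delta a''))))"
    (is "?L1 + ?L2 = ?R \<and> _")
proof -
  interpret translation_system n Q by unfold_locales fact
  have eq: "?L1 + ?L2 = ?R" using assms by (intro tau_identity) auto
  show ?thesis
  proof (intro conjI allI impI eq)
    fix \<gamma> :: "var \<Rightarrow> complex"
    assume "finite {x. \<gamma> x \<noteq> 0}"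
    note s = specialisable_tau[OF this]
    have "specialise \<gamma> (?L1 + ?L2) = specialise \<gamma> ?R" unfolding eq ..
    then show "specialise \<gamma> (tau n Q \<kappa> (\<beta> + delta_set I)) * specialise \<gamma> (tau n Q \<kappa> (\<beta> + delta_set J))
            + (\<Sum>b\<in>J. specialise \<gamma> (tau n Q (\<kappa> + delta b - delta a) (\<beta> + delta_set I))
                   * specialise \<gamma> (tau n Q (\<kappa> + delta a - delta b) (\<beta> + delta_set J)))
          = (\<Sum>a''\<in>I. specialise \<gamma> (tau n Q (\<kappa> + delta a'' - delta a) (\<beta> + delta_set I - delta a''))
                   * specialise \<gamma> (tau n Q (\<kappa> + delta a - delta a'') (\<beta> + delta_set J + delta a'')))"
      by (simp only: specialise_add specialise_sum specialise_mult specialisable_sum specialisable_mult s)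
  qed
qed

end
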